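(* The following are equivalent: (1) the orbit $\mathcal O$ is finite; (2) there exists a subfield $M\subset\mathbb K$ which is a finite Galois extension of both $k(x)$ and $k(y)$ and such that the groups $\mathrm{Gal}(M|k(x))$ and $\mathrm{Gal}(M|k(y))$ generate a finite group of automorphisms of $M$; (3) $k\subsetneq k(x)\cap k(y)$ (intersection taken inside $\mathbb K$), i.e. there exists a nontrivial Galois invariant.
   Context: Fix a finite set $\mathcal S\subset\mathbb Z^2$ and nonzero complex weights $(w_s)_{s\in\mathcal S}$; the step polynomial is $S(X,Y)=\sum_{(i,j)\in\mathcal S}w_{(i,j)}X^iY^j$, assumed not univariate (it involves both $X$ and $Y$). Let $x,y$ be algebraically independent over $\mathbb C$, $k=\mathbb C(S(x,y))$, and $\mathbb K$ a fixed algebraic closure of $\mathbb C(x,y)$. Write $(u,v)\sim^x(u',v')$ if $u=u'$ and $S(u,v)=S(u',v')$, and $(u,v)\sim^y(u',v')$ if $v=v'$ and $S(u,v)=S(u',v')$ (pairs in $\mathbb K\times\mathbb K$). The orbit $\mathcal O$ is the equivalence class of $(x,y)$ for the equivalence relation generated by $\sim^x$ and $\sim^y$. *)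

theory Defs
  imports "HOL-Algebra.Algebraic_Closure_Type" "HOL-Algebra.Generated_Fields"
    "HOL-Algebra.Generated_Groups" "HOL-Algebra.Bij"
begin

section \<open>Finite Galois extensions inside a field\<close>

text \<open>
  Splitting over \<open>M\<close> is expressed by \<^const>\<open>ring.splitted\<close> in the ring with carrier \<open>M\<close>. The library's
  \<^const>\<open>ring.splitted_on\<close> is not usable here: it intersects the multiset of roots with
  \<open>mset_set M\<close>, which is empty for infinite \<open>M\<close>.
\<close>

definition normal_ext :: "('a, 'b) ring_scheme \<Rightarrow> 'a set \<Rightarrow> 'a set \<Rightarrow> bool" where
  "normal_ext R L M \<longleftrightarrow>
     (\<forall>a\<in>M. ring.algebraic R L a \<and> ring.splitted (R\<lparr>carrier := M\<rparr>) (ring.Irr R L a))"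

text \<open>
  Multiplicities are taken in the ambient field \<open>R\<close>; this is the usual notion of separability
  when \<open>R\<close> is algebraically closed (or when the extension is normal).
\<close>

definition separable_ext :: "('a, 'b) ring_scheme \<Rightarrow> 'a set \<Rightarrow> 'a set \<Rightarrow> bool" where
  "separable_ext R L M \<longleftrightarrow>
     (\<forall>a\<in>M. ring.algebraic R L a \<and> (\<forall>r\<in>carrier R. ring.alg_mult R (ring.Irr R L a) r \<le> 1))"

definition finite_galois_ext :: "('a, 'b) ring_scheme \<Rightarrow> 'a set \<Rightarrow> 'a set \<Rightarrow> bool" where
  "finite_galois_ext R L M \<longleftrightarrow>
     subfield L R \<and> subfield M R \<and> L \<subseteq> M \<and>
     ring.finite_dimension R L M \<and> normal_ext R L M \<and> separable_ext R L M"

definition ring_auto :: "('a, 'b) ring_scheme \<Rightarrow> ('a \<Rightarrow> 'a) set" where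
  "ring_auto R = ring_hom R R \<inter> Bij (carrier R)"

definition RingAutoGroup :: "('a, 'b) ring_scheme \<Rightarrow> ('a \<Rightarrow> 'a) monoid" where
  "RingAutoGroup R = BijGroup (carrier R) \<lparr>carrier := ring_auto R\<rparr>"

definition Gal :: "('a, 'b) ring_scheme \<Rightarrow> 'a set \<Rightarrow> 'a set \<Rightarrow> ('a \<Rightarrow> 'a) set" where
  "Gal R M L = {\<sigma> \<in> ring_auto (R\<lparr>carrier := M\<rparr>). \<forall>a\<in>L. \<sigma> a = a}"


section \<open>The orbit of a step polynomial\<close>

text \<open>
  The ambient field is a type \<open>'k\<close>, regarded as a ring structure via \<^const>\<open>ring_of_type_algebra\<close>;
  the complex numbers are embedded in it by a ring homomorphism \<open>\<iota>\<close>.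
\<close>

definition alg_independent2 :: "(complex \<Rightarrow> 'k::field) \<Rightarrow> 'k \<Rightarrow> 'k \<Rightarrow> bool" where
  "alg_independent2 \<iota> x y \<longleftrightarrow>
     (\<forall>P :: complex poly poly. poly (map_poly (\<lambda>q. poly (map_poly \<iota> q) x) P) y = 0 \<longrightarrow> P = 0)"

definition step_eval ::
    "(complex \<Rightarrow> 'k::field) \<Rightarrow> (int \<times> int) set \<Rightarrow> (int \<times> int \<Rightarrow> complex) \<Rightarrow> 'k \<Rightarrow> 'k \<Rightarrow> 'k" where
  "step_eval \<iota> S w u v = (\<Sum>(i, j)\<in>S. \<iota> (w (i, j)) * u powi i * v powi j)"

text \<open>
  The value of the Laurent polynomial at \<open>(u, v)\<close> only makes sense if no negative power of zero
  occurs; \<open>powi\<close> would silently return \<open>0\<close> there, so the relations below ask for definedness.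
  All points in the orbit of \<open>(x, y)\<close> have nonzero coordinates.
\<close>

definition step_defined :: "(int \<times> int) set \<Rightarrow> 'k::field \<Rightarrow> 'k \<Rightarrow> bool" where
  "step_defined S u v \<longleftrightarrow> (\<forall>(i, j)\<in>S. (i < 0 \<longrightarrow> u \<noteq> 0) \<and> (j < 0 \<longrightarrow> v \<noteq> 0))"

definition same_step_value ::
    "(complex \<Rightarrow> 'k::field) \<Rightarrow> (int \<times> int) set \<Rightarrow> (int \<times> int \<Rightarrow> complex) \<Rightarrow> 'k \<times> 'k \<Rightarrow> 'k \<times> 'k \<Rightarrow> bool" where
  "same_step_value \<iota> S w p q \<longleftrightarrow>
     step_defined S (fst p) (snd p) \<and> step_defined S (fst q) (snd q) \<and>
     step_eval \<iota> S w (fst p) (snd p) = step_eval \<iota> S w (fst q) (snd q)"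

definition sim_x ::
    "(complex \<Rightarrow> 'k::field) \<Rightarrow> (int \<times> int) set \<Rightarrow> (int \<times> int \<Rightarrow> complex) \<Rightarrow> 'k \<times> 'k \<Rightarrow> 'k \<times> 'k \<Rightarrow> bool" where
  "sim_x \<iota> S w p q \<longleftrightarrow> fst p = fst q \<and> same_step_value \<iota> S w p q"

definition sim_y ::
    "(complex \<Rightarrow> 'k::field) \<Rightarrow> (int \<times> int) set \<Rightarrow> (int \<times> int \<Rightarrow> complex) \<Rightarrow> 'k \<times> 'k \<Rightarrow> 'k \<times> 'k \<Rightarrow> bool" where
  "sim_y \<iota> S w p q \<longleftrightarrow> snd p = snd q \<and> same_step_value \<iota> S w p q"

definition step_orbit ::
    "(complex \<Rightarrow> 'k::field) \<Rightarrow> (int \<times> int) set \<Rightarrow> (int \<times> int \<Rightarrow> complex) \<Rightarrow> 'k \<Rightarrow> 'k \<Rightarrow> ('k \<times> 'k) set" where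
  "step_orbit \<iota> S w x y = {q. equivclp (sup (sim_x \<iota> S w) (sim_y \<iota> S w)) (x, y) q}"

end

theory Submission
  imports Defs
begin

text \<open>
  The three conditions are proved cyclically; write \<open>t = S(x,y)\<close>, so that \<open>k = \<complex>(t)\<close>.

  If the orbit is finite, let \<open>M\<close> be generated over \<open>\<complex>\<close> by its coordinates. An embedding of \<open>M\<close>
  into \<open>K\<close> over \<open>k(x)\<close> or \<open>k(y)\<close> maps the orbit into itself, hence \<open>M\<close> into itself, so \<open>M\<close> is normal
  over both fields; and an automorphism is determined by its action on the finitely many coordinates.

  If \<open>M\<close> is as in (2) with finite group \<open>G\<close>, the polynomial \<open>\<Prod>(X - a)\<close> over the \<open>G\<close>-orbit of \<open>x\<close> has
  coefficients in \<open>k(x) \<inter> k(y)\<close>. This cannot be \<open>k\<close>, as \<open>x\<close> is transcendental over \<open>k\<close>.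

  If \<open>f \<in> k(x) \<inter> k(y)\<close> is not in \<open>k\<close>, then every point of the orbit is \<open>(\<phi> x, \<phi> y)\<close> for an embedding
  \<open>\<phi>\<close> of \<open>\<complex>(x,y)\<close> into \<open>K\<close> that fixes \<open>\<complex>\<close>, \<open>t\<close> and \<open>f\<close>: a step along \<open>\<sim>\<^sup>x\<close> changes \<open>\<phi>\<close> only off \<open>k(x)\<close>,
  a step along \<open>\<sim>\<^sup>y\<close> only off \<open>k(y)\<close>. Writing \<open>f = p(x)/q(x)\<close> over \<open>k\<close>, the first coordinates are
  roots of the nonzero polynomial \<open>p - f q\<close>, and similarly for the second ones.
\<close>

section \<open>Subfields and polynomials of a type-class field\<close>

abbreviation (input) type_ring :: "'k::field ring" where
  "type_ring \<equiv> ring_of_type_algebra"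

lemma type_ring_simps [simp]:
  "carrier (type_ring :: 'k::field ring) = UNIV"
  "a \<oplus>\<^bsub>type_ring\<^esub> b = a + (b :: 'k)"
  "a \<otimes>\<^bsub>type_ring\<^esub> b = a * (b :: 'k)"
  "\<zero>\<^bsub>type_ring\<^esub> = (0 :: 'k)"
  "\<one>\<^bsub>type_ring\<^esub> = (1 :: 'k)"
  by (simp_all add: ring_of_type_algebra_def)

text \<open>The total inverse satisfies \<open>inverse 0 = 0\<close>, so closure under inversion
  carries no side condition, and \<open>0\<close> arises as \<open>1 + (- 1)\<close>. Stated with
  type-class operations, this is the form in which field arithmetic is done below.\<close>

definition is_subfield :: "'k::field set \<Rightarrow> bool" where
  "is_subfield L \<longleftrightarrow> 1 \<in> L \<and> (\<forall>a\<in>L. - a \<in> L \<and> inverse a \<in> L) \<and>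
     (\<forall>a\<in>L. \<forall>b\<in>L. a + b \<in> L \<and> a * b \<in> L)"

abbreviation (input) gen :: "'k::field set \<Rightarrow> 'k set" where
  "gen A \<equiv> generate_field type_ring A"

context
begin

interpretation type_ring: field "type_ring :: 'k::field ring"
  by (rule field_from_type_algebra)

lemma type_ring_a_inv [simp]: "\<ominus>\<^bsub>type_ring\<^esub> a = - (a :: 'k::field)"
  by (metis UNIV_I add.right_inverse add_eq_0_iff type_ring.r_neg type_ring_simps(1,2,4))

lemma type_ring_m_inv [simp]:
  assumes "a \<noteq> 0"
  shows "inv\<^bsub>type_ring\<^esub> a = inverse (a :: 'k::field)"
  using assms by (intro type_ring.inv_char) auto

lemma type_ring_pow [simp]: "a [^]\<^bsub>type_ring\<^esub> (n::nat) = (a :: 'k::field) ^ n"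
  by (induction n) (auto simp: type_ring.nat_pow_Suc mult.commute)

lemma is_subfieldD:
  assumes "is_subfield L"
  shows "1 \<in> L" "0 \<in> L" "a \<in> L \<Longrightarrow> - a \<in> L" "a \<in> L \<Longrightarrow> inverse a \<in> L"
    "a \<in> L \<Longrightarrow> b \<in> L \<Longrightarrow> a + b \<in> L" "a \<in> L \<Longrightarrow> b \<in> L \<Longrightarrow> a - b \<in> L"
    "a \<in> L \<Longrightarrow> b \<in> L \<Longrightarrow> a * b \<in> L" "a \<in> L \<Longrightarrow> b \<in> L \<Longrightarrow> a / b \<in> L"
proof -
  have *: "\<And>a b. a \<in> L \<Longrightarrow> b \<in> L \<Longrightarrow> a + b \<in> L" "\<And>a. a \<in> L \<Longrightarrow> - a \<in> L"
    "\<And>a b. a \<in> L \<Longrightarrow> b \<in> L \<Longrightarrow> a * b \<in> L" "\<And>a. a \<in> L \<Longrightarrow> inverse a \<in> L" "1 \<in> L"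
    using assms unfolding is_subfield_def by blast+
  show "1 \<in> L" "0 \<in> L" "a \<in> L \<Longrightarrow> - a \<in> L" "a \<in> L \<Longrightarrow> inverse a \<in> L"
    "a \<in> L \<Longrightarrow> b \<in> L \<Longrightarrow> a + b \<in> L" "a \<in> L \<Longrightarrow> b \<in> L \<Longrightarrow> a - b \<in> L"
    "a \<in> L \<Longrightarrow> b \<in> L \<Longrightarrow> a * b \<in> L" "a \<in> L \<Longrightarrow> b \<in> L \<Longrightarrow> a / b \<in> L"
    using *(1)[of 1 "- 1"] *(1)[of a "- b"] *(3)[of a "inverse b"] * by (auto simp: divide_inverse)
qed

lemma is_subfield_power: "is_subfield L \<Longrightarrow> a \<in> L \<Longrightarrow> a ^ n \<in> L"
  by (induction n) (auto intro: is_subfieldD)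

lemma is_subfield_powi: "is_subfield L \<Longrightarrow> a \<in> L \<Longrightarrow> a powi n \<in> L"
  by (auto simp: power_int_def intro!: is_subfield_power is_subfieldD)

lemma is_subfield_sum: "is_subfield L \<Longrightarrow> (\<And>i. i \<in> I \<Longrightarrow> f i \<in> L) \<Longrightarrow> sum f I \<in> L"
  by (induction I rule: infinite_finite_induct) (auto intro: is_subfieldD)

lemma subfield_type_ring_iff: "subfield L type_ring \<longleftrightarrow> is_subfield L"
proof
  assume L: "subfield L type_ring"
  note sr = subringE[OF subfieldE(1)[OF L]]
  have "inverse a \<in> L" if "a \<in> L" for a
    using type_ring.subfield_m_inv(1)[OF L, of a] that by (cases "a = 0") auto
  then show "is_subfield L"
    using sr unfolding is_subfield_def by auto
next
  assume L: "is_subfield L"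
  show "subfield L type_ring"
    by (intro type_ring.subfieldI' type_ring.subringI)
       (use is_subfieldD[OF L] in auto)
qed

lemma is_subfield_gen: "is_subfield (gen A)"
  using type_ring.generate_field_is_subfield[of A] by (simp add: subfield_type_ring_iff)

lemma gen_least: "is_subfield L \<Longrightarrow> A \<subseteq> L \<Longrightarrow> gen A \<subseteq> L"
  using type_ring.generate_field_min_subfield1[of A L] by (simp add: subfield_type_ring_iff)

lemma gen_incl: "A \<subseteq> gen A"
  by (auto intro: generate_field.incl)

lemma gen_mono: "A \<subseteq> B \<Longrightarrow> gen A \<subseteq> gen B"
  by (meson gen_incl gen_least is_subfield_gen subset_trans)


end

text \<open>All polynomials have coefficient type \<open>'k\<close>; a subfield enters only as a
  constraint on coefficients, so a change of subfield never changes the polynomial.\<close>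

definition poly_over :: "'k::field set \<Rightarrow> 'k poly \<Rightarrow> bool" where
  "poly_over L p \<longleftrightarrow> (\<forall>i. Polynomial.coeff p i \<in> L)"

lemma poly_over_mono: "poly_over L p \<Longrightarrow> L \<subseteq> L' \<Longrightarrow> poly_over L' p"
  by (auto simp: poly_over_def)

lemma poly_over_intros:
  assumes "is_subfield L"
  shows "poly_over L 0" "poly_over L 1"
    "a \<in> L \<Longrightarrow> poly_over L p \<Longrightarrow> poly_over L (pCons a p)"
    "a \<in> L \<Longrightarrow> poly_over L (Polynomial.monom a n)"
    "a \<in> L \<Longrightarrow> poly_over L p \<Longrightarrow> poly_over L (Polynomial.smult a p)"
    "poly_over L p \<Longrightarrow> poly_over L q \<Longrightarrow> poly_over L (p + q)"
    "poly_over L p \<Longrightarrow> poly_over L q \<Longrightarrow> poly_over L (p - q)"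
    "poly_over L p \<Longrightarrow> poly_over L q \<Longrightarrow> poly_over L (p * q)"
  using is_subfieldD[OF assms]
  by (auto simp: poly_over_def coeff_pCons Polynomial.coeff_mult split: nat.splits intro!: is_subfield_sum[OF assms])

lemma poly_over_prod:
  assumes "is_subfield L" "\<And>i. i \<in> I \<Longrightarrow> poly_over L (f i)"
  shows "poly_over L (prod f I)"
  using assms(2)
  by (induction I rule: infinite_finite_induct) (auto intro: poly_over_intros[OF assms(1)])

lemma poly_over_sum:
  assumes "is_subfield L" "\<And>i. i \<in> I \<Longrightarrow> poly_over L (f i)"
  shows "poly_over L (sum f I)"
  using assms(2)
  by (induction I rule: infinite_finite_induct) (auto intro: poly_over_intros[OF assms(1)])

lemma poly_over_pCons_iff: "poly_over L (pCons a p) \<longleftrightarrow> a \<in> L \<and> poly_over L p"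
  unfolding poly_over_def by (metis coeff_pCons_0 coeff_pCons_Suc not0_implies_Suc)

lemma poly_over_pderiv:
  assumes "is_subfield L" "poly_over L p"
  shows "poly_over L (pderiv p)"
proof -
  have "of_nat n \<in> L" for n
    by (induction n) (auto intro: is_subfieldD[OF assms(1)])
  then show ?thesis
    using assms unfolding poly_over_def coeff_pderiv by (auto intro: is_subfieldD)
qed

lemma poly_in_subfield: "is_subfield L \<Longrightarrow> poly_over L p \<Longrightarrow> a \<in> L \<Longrightarrow> poly p a \<in> L"
  unfolding poly_altdef poly_over_def
  by (intro is_subfield_sum is_subfieldD(7) is_subfield_power) auto

text \<open>The leading term of \<open>p\<close> is cancelled with the quotient of two leading
  coefficients, which lies in \<open>L\<close>. Induction on the degree thus keeps quotient and
  remainder over \<open>L\<close>.\<close>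

lemma poly_over_division:
  assumes L: "is_subfield L" and "poly_over L p" "poly_over L m" "m \<noteq> 0"
  obtains q r where "poly_over L q" "poly_over L r" "p = m * q + r"
    "r = 0 \<or> Polynomial.degree r < Polynomial.degree m"
proof -
  have "\<exists>q r. poly_over L q \<and> poly_over L r \<and> p = m * q + r \<and>
          (r = 0 \<or> Polynomial.degree r < Polynomial.degree m)"
    using assms(2)
  proof (induction "Polynomial.degree p" arbitrary: p rule: less_induct)
    case less
    show ?case
    proof (cases "p = 0 \<or> Polynomial.degree p < Polynomial.degree m")
      case True
      then show ?thesis
        using less.prems poly_over_intros(1)[OF L] by (intro exI[of _ 0] exI[of _ p]) auto
    next
      case False
      define d where "d = Polynomial.degree p - Polynomial.degree m"
      define c where "c = Polynomial.lead_coeff p / Polynomial.lead_coeff m"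
      define s where "s = Polynomial.monom c d"
      have "c \<noteq> 0"
        using False \<open>m \<noteq> 0\<close> by (simp add: c_def)
      define p' where "p' = p - m * s"
      have ms: "Polynomial.degree (m * s) = Polynomial.degree p"
        using False \<open>m \<noteq> 0\<close> \<open>c \<noteq> 0\<close>
        by (simp add: s_def degree_mult_eq degree_monom_eq d_def)
      have s: "poly_over L s"
        unfolding s_def c_def using less.prems assms(3) L
        by (intro poly_over_intros is_subfieldD) (auto simp: poly_over_def)
      then have p': "poly_over L p'"
        unfolding p'_def using less.prems assms(3) poly_over_intros[OF L] by blast
      have "Polynomial.lead_coeff s = c"
        using \<open>c \<noteq> 0\<close> by (simp add: s_def degree_monom_eq)
      then have lc: "Polynomial.lead_coeff (m * s) = Polynomial.lead_coeff p"
        using \<open>m \<noteq> 0\<close> by (simp add: Polynomial.lead_coeff_mult c_def)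
      \<comment> \<open>The alternative \<open>p' = 0\<close> is essential: the zero polynomial has
        degree \<open>0\<close> by convention, so the degree need not drop when \<open>p\<close> is
        constant.\<close>
      have deg: "p' = 0 \<or> Polynomial.degree p' < Polynomial.degree p"
        unfolding p'_def using lc ms
        by (metis coeff_diff degree_diff_le eq_iff_diff_eq_0 le_eq_less_or_eq leading_coeff_0_iff order_refl)
      show ?thesis
      proof (cases "p' = 0")
        case True
        then have "p = m * s + 0" by (simp add: p'_def)
        then show ?thesis using s poly_over_intros(1)[OF L] by blast
      next
        case F: False
        then obtain q r where qr: "poly_over L q" "poly_over L r" "p' = m * q + r"
          "r = 0 \<or> Polynomial.degree r < Polynomial.degree m"
          using less.hyps[OF _ p'] deg by blast
        then have "p = m * (q + s) + r"
          by (simp add: p'_def algebra_simps)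
        then show ?thesis
          using qr poly_over_intros(6)[OF L qr(1) s] by blast
      qed
    qed
  qed
  then show ?thesis using that by blast
qed

section \<open>Algebraic elements\<close>

definition alg :: "'k::field set \<Rightarrow> 'k \<Rightarrow> bool" where
  "alg L a \<longleftrightarrow> (\<exists>p. p \<noteq> 0 \<and> poly_over L p \<and> poly p a = 0)"

lemma alg_mono: "alg L a \<Longrightarrow> L \<subseteq> L' \<Longrightarrow> alg L' a"
  unfolding alg_def using poly_over_mono by blast

text \<open>Take \<open>m\<close> as a nonzero annihilator of least degree; dividing any other
  annihilator by \<open>m\<close> leaves remainder zero. No monic normalisation is made, since later
  arguments use only divisibility and minimality.\<close>

lemma minimal_poly_exists:
  assumes L: "is_subfield L" and "alg L a"
  obtains m where "m \<noteq> 0" "poly_over L m" "poly m a = 0" "Polynomial.degree m > 0"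
    "\<And>p. poly_over L p \<Longrightarrow> poly p a = 0 \<Longrightarrow> \<exists>q. poly_over L q \<and> p = m * q"
    "\<And>p. poly_over L p \<Longrightarrow> poly p a = 0 \<Longrightarrow> p \<noteq> 0 \<Longrightarrow> Polynomial.degree m \<le> Polynomial.degree p"
proof -
  define P where "P m \<longleftrightarrow> m \<noteq> 0 \<and> poly_over L m \<and> poly m a = 0" for m
  obtain m where m: "P m" and min: "\<And>p. P p \<Longrightarrow> Polynomial.degree m \<le> Polynomial.degree p"
    using assms(2) ex_has_least_nat[of P _ Polynomial.degree] unfolding alg_def P_def by metis
  have "Polynomial.degree m > 0"
    using m unfolding P_def by (metis bot_nat_0.not_eq_extremum poly_const_conv degree_eq_zeroE pCons_eq_0_iff)
  moreover have "\<exists>q. poly_over L q \<and> p = m * q" if p: "poly_over L p" "poly p a = 0" for p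
  proof -
    obtain q r where qr: "poly_over L q" "poly_over L r" "p = m * q + r"
      "r = 0 \<or> Polynomial.degree r < Polynomial.degree m"
      using poly_over_division[OF L p(1), of m] m P_def by blast
    have "poly r a = 0" using p m qr(3) by (simp add: P_def)
    then have "r = 0" using min[of r] qr P_def by fastforce
    then show ?thesis using qr by auto
  qed
  ultimately show ?thesis
    using that m min unfolding P_def by blast
qed

definition alg_closed :: "'k::field itself \<Rightarrow> bool" where
  "alg_closed _ \<longleftrightarrow> (\<forall>p :: 'k poly. Polynomial.degree p > 0 \<longrightarrow> (\<exists>a. poly p a = 0))"

section \<open>Algebraic and finite extensions, and the passage to list polynomials\<close>

context
begin

interpretation type_ring: field "type_ring :: 'k::field ring"
  by (rule field_from_type_algebra)

text \<open>List polynomials have their leading coefficient first, while \<open>Poly\<close> reads a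
  list from the constant term upwards; hence the \<open>rev\<close> in every translation.\<close>

lemma eval_type_ring: "type_ring.eval p a = poly (Poly (rev p)) a"
  by (induction p) (auto simp: Poly_append poly_monom)

lemma poly_over_of_carrier:
  assumes "is_subfield L" "p \<in> carrier (univ_poly type_ring L)"
  shows "poly_over L (Poly (rev p))"
  using assms is_subfieldD(2)[OF assms(1)]
  by (auto simp: poly_over_def univ_poly_carrier[symmetric] polynomial_def nth_default_def)
     (metis length_rev nth_mem set_rev subsetD)

lemma Poly_rev_neq_0:
  assumes "p \<in> carrier (univ_poly type_ring L)" "p \<noteq> []"
  shows "Poly (rev p) \<noteq> 0"
proof
  assume "Poly (rev p) = 0"
  then obtain n where n: "rev p = replicate n 0" by (auto simp: Poly_eq_0)
  then have "p = replicate n 0" by (metis rev_replicate rev_rev_ident)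
  with assms show False
    by (cases n) (auto simp: univ_poly_carrier[symmetric] polynomial_def)
qed

lemma rev_coeffs_in_carrier:
  assumes "poly_over L p"
  shows "rev (coeffs p) \<in> carrier (univ_poly type_ring L)"
proof (cases "p = 0")
  case False
  then have "hd (rev (coeffs p)) \<noteq> 0"
    by (simp add: hd_rev last_coeffs_eq_coeff_degree)
  moreover have "set (rev (coeffs p)) \<subseteq> L"
    using assms by (auto simp: poly_over_def coeffs_def)
  ultimately show ?thesis
    by (auto simp: univ_poly_carrier[symmetric] polynomial_def)
qed (simp add: univ_poly_carrier[symmetric] polynomial_def)

lemma algebraic_type_ring_iff:
  assumes "is_subfield L"
  shows "type_ring.algebraic L a \<longleftrightarrow> alg L a"
proof
  assume "type_ring.algebraic L a"
  then obtain p where p: "p \<in> carrier (univ_poly type_ring L)" "p \<noteq> []" "type_ring.eval p a = 0"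
    using type_ring.algebraicE[of L a] assms
    by (auto simp: over_def simp flip: subfield_type_ring_iff dest: subfieldE(1))
  then show "alg L a"
    using poly_over_of_carrier[OF assms] Poly_rev_neq_0
    unfolding alg_def by (intro exI[of _ "Poly (rev p)"]) (simp add: eval_type_ring)
next
  assume "alg L a"
  then obtain p where p: "p \<noteq> 0" "poly_over L p" "poly p a = 0"
    unfolding alg_def by blast
  then show "type_ring.algebraic L a"
    using type_ring.algebraicI[of "rev (coeffs p)" L a] rev_coeffs_in_carrier[of L p]
    by (simp add: over_def eval_type_ring)
qed

lemma is_subfield_algebraics:
  assumes "is_subfield L"
  shows "is_subfield {a. alg L a}"
  using type_ring.subfield_of_algebraics[of L] assms
  by (simp add: subfield_type_ring_iff over_def algebraic_type_ring_iff)

lemma alg_self: "is_subfield L \<Longrightarrow> a \<in> L \<Longrightarrow> alg L a"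
  unfolding alg_def
  by (intro exI[of _ "[:-a, 1:]"]) (auto intro!: poly_over_intros intro: is_subfieldD simp: one_pCons[symmetric])

text \<open>Finite dimension is available for the iterated simple extensions
  \<open>finite_extension\<close>. Identifying these with the generated field transfers it to
  \<open>gen\<close>.\<close>

lemma finite_extension_eq_gen:
  assumes "is_subfield L" "\<And>a. a \<in> set as \<Longrightarrow> alg L a"
  shows "type_ring.finite_extension L as = gen (L \<union> set as)"
    and "type_ring.finite_dimension L (gen (L \<union> set as))"
proof -
  have L: "subfield L type_ring" using assms(1) by (simp add: subfield_type_ring_iff)
  let ?E = "type_ring.finite_extension L as"
  have al: "(type_ring.algebraic over L) a" if "a \<in> set as" for a
    using assms that by (simp add: over_def algebraic_type_ring_iff)
  have sf: "is_subfield ?E"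
    using type_ring.finite_extension_is_subfield[OF L, of as] al
    by (simp add: subfield_type_ring_iff del: type_ring.finite_extension.simps)
  have "L \<subseteq> ?E" "set as \<subseteq> ?E"
    using type_ring.finite_extension_incl[of L as] type_ring.finite_extension_mem[OF subfieldE(1)[OF L], of as]
    by (simp_all del: type_ring.finite_extension.simps)
  then have "gen (L \<union> set as) \<subseteq> ?E"
    using sf by (intro gen_least) auto
  moreover have "?E \<subseteq> gen (L \<union> set as)"
    using type_ring.finite_extension_subring_incl[of "gen (L \<union> set as)" L as]
      gen_incl[of "L \<union> set as"] is_subfield_gen[of "L \<union> set as"]
    by (simp add: subfieldE(1) subfield_type_ring_iff del: type_ring.finite_extension.simps)
  ultimately show eq: "?E = gen (L \<union> set as)" by blast
  show "type_ring.finite_dimension L (gen (L \<union> set as))"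
    using type_ring.finite_extension_finite_dimension(1)[OF L, of as] al
    by (simp add: eq del: type_ring.finite_extension.simps)
qed

lemma finite_dimension_imp_alg:
  assumes "is_subfield L" "is_subfield M" "type_ring.finite_dimension L M" "a \<in> M"
  shows "alg L a"
  using type_ring.finite_dimension_imp_algebraic[of L M a] assms
  by (simp add: subfield_type_ring_iff subfieldE(1) over_def algebraic_type_ring_iff)

text \<open>The finitely many coefficients of an annihilator of \<open>b\<close> generate a field
  \<open>E\<close> of finite dimension over \<open>L\<close>, and \<open>E(b)\<close> is finite over
  \<open>E\<close>. Multiplicativity in towers makes \<open>E(b)\<close> finite over
  \<open>L\<close>.\<close>

lemma alg_trans:
  assumes L: "is_subfield L" and "alg {a. alg L a} b"
  shows "alg L b"
proof -
  obtain p where p: "p \<noteq> 0" "poly_over {a. alg L a} p" "poly p b = 0"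
    using assms(2) unfolding alg_def by blast
  define E where "E = gen (L \<union> set (coeffs p))"
  have as: "\<And>a. a \<in> set (coeffs p) \<Longrightarrow> alg L a"
    using p(2) by (auto simp: poly_over_def coeffs_def split: if_splits)
  have E: "is_subfield E" unfolding E_def by (rule is_subfield_gen)
  have 1: "type_ring.finite_dimension L E"
    unfolding E_def by (rule finite_extension_eq_gen(2)[OF L as])
  have "poly_over E p"
    unfolding poly_over_def
  proof
    fix i
    show "Polynomial.coeff p i \<in> E"
    proof (cases "i \<le> Polynomial.degree p")
      case True
      then have "Polynomial.coeff p i \<in> set (coeffs p)"
        by (metis coeff_in_coeffs p(1))
      then show ?thesis using gen_incl[of "L \<union> set (coeffs p)"] by (auto simp: E_def)
    qed (simp add: coeff_eq_0 is_subfieldD(2)[OF E])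
  qed
  then have "alg E b" using p unfolding alg_def by blast
  then have 2: "type_ring.finite_dimension E (gen (E \<union> {b}))"
    using finite_extension_eq_gen(2)[OF E, of "[b]"] by simp
  have "type_ring.finite_dimension L (gen (E \<union> {b}))"
    using type_ring.telescopic_base_dim(1)[OF _ _ 1 2] L E by (simp add: subfield_type_ring_iff)
  then show ?thesis
    using finite_dimension_imp_alg[OF L is_subfield_gen] gen_incl[of "E \<union> {b}"] by blast
qed

text \<open>A spanning list serves as \<open>A\<close>. The conclusion is a containment in every
  suitable \<open>L'\<close> because embeddings will later be extended to some unspecified larger
  field that contains \<open>A\<close>.\<close>

lemma finite_dimension_generators:
  assumes L: "is_subfield L" and "type_ring.finite_dimension L M"
  obtains A where "finite A" "\<And>L'. is_subfield L' \<Longrightarrow> L \<subseteq> L' \<Longrightarrow> A \<subseteq> L' \<Longrightarrow> M \<subseteq> L'"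
proof -
  have sL: "subfield L type_ring" using L by (simp add: subfield_type_ring_iff)
  obtain Us where Us: "type_ring.Span L Us = M"
    using assms(2) type_ring.exists_base[OF sL] unfolding type_ring.finite_dimension_def by metis
  have "type_ring.Span L Us \<subseteq> L'" if "is_subfield L'" "L \<subseteq> L'" "set Us \<subseteq> L'" for L'
    using that(3)
  proof (induction Us)
    case Nil
    then show ?case using is_subfieldD[OF that(1)] by simp
  next
    case (Cons u Us)
    then show ?case
      using that(2)
      by (auto simp: type_ring.line_extension_mem_iff intro!: is_subfieldD(5,7)[OF that(1)])
  qed
  then show ?thesis using that[of "set Us"] Us by blast
qed

lemma alg_closed_of_closure:
  assumes "algebraic_closure type_ring (F :: 'k::field set)"
  shows "alg_closed TYPE('k)"
  unfolding alg_closed_def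
proof (intro allI impI)
  interpret cl: algebraic_closure "type_ring :: 'k ring" F by fact
  fix p :: "'k poly" assume deg: "Polynomial.degree p > 0"
  define P where "P = rev (coeffs p)"
  have P: "P \<in> carrier (poly_ring type_ring)"
    unfolding P_def by (simp add: rev_coeffs_in_carrier poly_over_def)
  then have "type_ring.splitted P"
    by (rule cl.roots_over_carrier)
  then have "type_ring.roots P \<noteq> {#}"
    using deg by (auto simp: type_ring.splitted_def P_def degree_eq_length_coeffs)
  then obtain a where "a \<in># type_ring.roots P" by blast
  then have "type_ring.eval P a = 0"
    using type_ring.roots_mem_iff_is_root[OF P] by (simp add: type_ring.is_root_def)
  then show "\<exists>a. poly p a = 0"
    by (auto simp: eval_type_ring P_def)
qed

lemma alg_of_closure:
  assumes "algebraic_closure type_ring (F :: 'k::field set)"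
  shows "alg F a" "is_subfield F"
proof -
  interpret cl: algebraic_closure "type_ring :: 'k ring" F by fact
  show F: "is_subfield F"
    using cl.subfield_axioms by (simp add: subfield_type_ring_iff)
  show "alg F a" 
    using cl.algebraic_extension[of a] algebraic_type_ring_iff[OF F] by (simp add: over_def)
qed

end

section \<open>Simple extensions, clearing denominators and the exchange property\<close>

definition adjoin :: "'k::field set \<Rightarrow> 'k \<Rightarrow> 'k set" where
  "adjoin L c = {poly p c / poly q c | p q. poly_over L p \<and> poly_over L q}"

text \<open>A vanishing denominator in \<open>adjoin\<close> yields the harmless value
  \<open>0\<close>, but forces a case split for sums. Explicit fractions suit polynomial
  computations; the generated field suits containments.\<close>

lemma adjoin_eq_gen:
  assumes L: "is_subfield L"
  shows "adjoin L c = gen (L \<union> {c})"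
proof
  note [intro] = poly_over_intros[OF L]
  have in_adj: "poly p c / poly q c \<in> adjoin L c" if "poly_over L p" "poly_over L q" for p q
    using that unfolding adjoin_def by blast
  show "adjoin L c \<subseteq> gen (L \<union> {c})"
    unfolding adjoin_def
    using gen_incl[of "L \<union> {c}"] is_subfield_gen[of "L \<union> {c}"]
    by (auto intro!: is_subfieldD(8) poly_in_subfield intro: poly_over_mono)
  have inc: "L \<union> {c} \<subseteq> adjoin L c"
    using in_adj[of "[:_:]" 1] in_adj[of "[:0, 1:]" 1] is_subfieldD(1,2)[OF L] by auto
  have "is_subfield (adjoin L c)"
    unfolding is_subfield_def
  proof (intro conjI ballI)
    show "1 \<in> adjoin L c"
      using inc is_subfieldD(1)[OF L] by auto
  next
    fix a assume "a \<in> adjoin L c"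
    then obtain p q where a: "a = poly p c / poly q c" "poly_over L p" "poly_over L q"
      unfolding adjoin_def by blast
    show "- a \<in> adjoin L c"
      using in_adj[OF poly_over_intros(7)[OF L poly_over_intros(1)[OF L] a(2)] a(3)] a(1) by simp
    show "inverse a \<in> adjoin L c"
      using in_adj[of q p] a by auto
    fix b assume "b \<in> adjoin L c"
    then obtain p' q' where b: "b = poly p' c / poly q' c" "poly_over L p'" "poly_over L q'"
      unfolding adjoin_def by blast
    show "a * b \<in> adjoin L c"
      using in_adj[of "p * p'" "q * q'"] a b by auto
    show "a + b \<in> adjoin L c"
    proof (cases "poly q c = 0 \<or> poly q' c = 0")
      case True
      then show ?thesis using in_adj a b by auto
    next
      case False
      have "a + b = poly (p * q' + p' * q) c / poly (q * q') c"
        unfolding a(1) b(1) using False by (simp add: add_frac_eq)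
      moreover have "poly_over L (p * q' + p' * q)" "poly_over L (q * q')"
        using a b by auto
      ultimately show ?thesis using in_adj by metis
    qed
  qed
  then show "gen (L \<union> {c}) \<subseteq> adjoin L c"
    using inc by (rule gen_least)
qed

text \<open>\<open>Q\<close> is a bivariate polynomial over \<open>L\<close> whose inner variable is
  set to \<open>c\<close>. The induction needs the stronger form in which the common denominator
  \<open>e\<close> is itself a value \<open>poly b c\<close> with \<open>b\<close> over
  \<open>L\<close>.\<close>

lemma clear_denominators:
  assumes L: "is_subfield L" and "poly_over (adjoin L c) p"
  obtains Q e where "\<And>i. poly_over L (Polynomial.coeff Q i)" "e \<noteq> 0"
    "map_poly (\<lambda>q. poly q c) Q = Polynomial.smult e p"
proof -
  note [intro] = poly_over_intros[OF L]
  have "\<exists>Q b. (\<forall>i. poly_over L (Polynomial.coeff Q i)) \<and> poly_over L b \<and> poly b c \<noteq> 0 \<and>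
          map_poly (\<lambda>q. poly q c) Q = Polynomial.smult (poly b c) p"
    using assms(2)
  proof (induction p)
    case 0
    show ?case by (intro exI[of _ 0] exI[of _ 1]) auto
  next
    case (pCons a p)
    then obtain Q b where Q: "\<And>i. poly_over L (Polynomial.coeff Q i)" "poly_over L b" "poly b c \<noteq> 0"
      "map_poly (\<lambda>q. poly q c) Q = Polynomial.smult (poly b c) p"
      unfolding poly_over_pCons_iff by blast
    obtain r s where rs: "poly_over L r" "poly_over L s" "a = poly r c / poly s c" "poly s c \<noteq> 0"
    proof -
      obtain r s where "poly_over L r" "poly_over L s" "a = poly r c / poly s c"
        using pCons.prems unfolding poly_over_pCons_iff adjoin_def by blast
      then show ?thesis
        using that[of r s] that[of 0 1] by (cases "poly s c = 0") auto
    qed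
    \<comment> \<open>If \<open>b(c)\<close> clears the tail and the new coefficient is
      \<open>r(c) / s(c)\<close>, then \<open>b s\<close> clears the whole polynomial.\<close>
    define Q' where "Q' = pCons (b * r) (Polynomial.smult s Q)"
    have "poly_over L (Polynomial.coeff Q' i)" for i
      using Q(1,2) rs by (cases i) (auto simp: Q'_def)
    moreover have "map_poly (\<lambda>q. poly q c) Q' = Polynomial.smult (poly (b * s) c) (pCons a p)"
    proof (rule poly_eqI)
      fix i
      have *: "poly (Polynomial.coeff Q j) c = poly b c * Polynomial.coeff p j" for j
        using arg_cong[OF Q(4), of "\<lambda>p. Polynomial.coeff p j"] by (simp add: coeff_map_poly)
      show "Polynomial.coeff (map_poly (\<lambda>q. poly q c) Q') i =
          Polynomial.coeff (Polynomial.smult (poly (b * s) c) (pCons a p)) i"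
        using rs(3,4) by (cases i) (auto simp: Q'_def coeff_map_poly *)
    qed
    moreover have "poly_over L (b * s)" "poly (b * s) c \<noteq> 0"
      using Q rs by auto
    ultimately show ?case by blast
  qed
  then show ?thesis using that by blast
qed

lemma poly_map_poly_eval:
  fixes c :: "'k::field"
  shows
  "poly (map_poly (\<lambda>q. poly q c) Q) d =
     (\<Sum>i\<le>Polynomial.degree Q. poly (Polynomial.coeff Q i) c * d ^ i)"
proof -
  let ?q = "map_poly (\<lambda>q. poly q c) Q"
  have "poly ?q d = (\<Sum>i\<le>Polynomial.degree Q. Polynomial.coeff ?q i * d ^ i)"
    unfolding poly_altdef[of ?q]
    by (intro sum.mono_neutral_left) (use map_poly_degree_leq[of "\<lambda>q. poly q c" Q] in \<open>auto simp: coeff_eq_0\<close>)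
  then show ?thesis by (simp add: coeff_map_poly)
qed

text \<open>This is Steinitz exchange. Clearing denominators turns the relation for \<open>a\<close>
  over \<open>L(b)\<close> into a bivariate relation between \<open>a\<close> and \<open>b\<close>,
  which is then read as a polynomial \<open>R\<close> in \<open>b\<close> with coefficients in
  \<open>L(a)\<close>.\<close>

lemma alg_exchange:
  assumes L: "is_subfield L" and "alg (adjoin L b) a" "\<not> alg L a"
  shows "alg (adjoin L a) b"
proof -
  obtain p where p: "p \<noteq> 0" "poly_over (adjoin L b) p" "poly p a = 0"
    using assms(2) unfolding alg_def by blast
  obtain Q e where Q: "\<And>i. poly_over L (Polynomial.coeff Q i)" "e \<noteq> 0"
    "map_poly (\<lambda>q. poly q b) Q = Polynomial.smult e p"
    by (rule clear_denominators[OF L p(2)]) blast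
  have "Q \<noteq> 0" using Q(2,3) p(1) by auto
  define n where "n = Polynomial.degree Q"
  define R where "R = (\<Sum>i\<le>n. Polynomial.smult (a ^ i) (Polynomial.coeff Q i))"
  note sf = is_subfield_gen[of "L \<union> {a}", folded adjoin_eq_gen[OF L]]
  have inc: "L \<subseteq> adjoin L a" "a \<in> adjoin L a"
    using gen_incl[of "L \<union> {a}"] by (auto simp: adjoin_eq_gen[OF L])
  have "poly_over (adjoin L a) R"
    unfolding R_def using Q(1) inc
    by (intro poly_over_sum[OF sf] poly_over_intros[OF sf] is_subfield_power[OF sf])
       (auto intro: poly_over_mono)
  moreover have "poly R b = 0"
  proof -
    have "poly R b = poly (map_poly (\<lambda>q. poly q b) Q) a"
      unfolding poly_map_poly_eval by (simp add: R_def n_def poly_sum mult.commute)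
    then show ?thesis using p(3) by (simp add: Q(3))
  qed
  moreover have "R \<noteq> 0"
  proof
    assume "R = 0"
    \<comment> \<open>If \<open>R\<close> vanished, so would its \<open>j\<close>-th coefficient,
      which is the value at \<open>a\<close> of a polynomial \<open>T\<close> over \<open>L\<close>.
      The choice of \<open>j\<close> makes the \<open>n\<close>-th coefficient of \<open>T\<close>
      nonzero, so \<open>a\<close> would be algebraic over \<open>L\<close>.\<close>
    obtain j where j: "Polynomial.coeff (Polynomial.coeff Q n) j \<noteq> 0"
      using \<open>Q \<noteq> 0\<close> by (metis n_def leading_coeff_0_iff)
    define T where "T = (\<Sum>i\<le>n. Polynomial.monom (Polynomial.coeff (Polynomial.coeff Q i) j) i)"
    have "poly_over L T"
      unfolding T_def using Q(1)
      by (intro poly_over_sum[OF L] poly_over_intros[OF L]) (auto simp: poly_over_def)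
    moreover have "poly T a = Polynomial.coeff R j"
      by (simp add: T_def R_def poly_sum poly_monom Polynomial.coeff_sum mult.commute)
    moreover have "Polynomial.coeff T n \<noteq> 0"
      using j by (simp add: T_def Polynomial.coeff_sum)
    ultimately show False
      using assms(3) \<open>R = 0\<close> unfolding alg_def by (metis coeff_0)
  qed
  ultimately show ?thesis unfolding alg_def by blast
qed


section \<open>Field embeddings\<close>

text \<open>Maps are total and constrained only on \<open>L\<close>, so a single map can be
  considered on several subfields. The condition \<open>\<sigma> 1 = 1\<close> rules out the zero
  map and forces injectivity on a subfield.\<close>

definition field_emb :: "'k::field set \<Rightarrow> ('k \<Rightarrow> 'k) \<Rightarrow> bool" where
  "field_emb L \<sigma> \<longleftrightarrow> \<sigma> 1 = 1 \<and> (\<forall>a\<in>L. \<forall>b\<in>L. \<sigma> (a + b) = \<sigma> a + \<sigma> b \<and> \<sigma> (a * b) = \<sigma> a * \<sigma> b)"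

lemma field_emb_mono: "field_emb L' \<sigma> \<Longrightarrow> L \<subseteq> L' \<Longrightarrow> field_emb L \<sigma>"
  unfolding field_emb_def by blast

lemma field_emb_simps:
  assumes "field_emb L \<sigma>" "is_subfield L"
  shows "\<sigma> 1 = 1" "\<sigma> 0 = 0"
    "a \<in> L \<Longrightarrow> b \<in> L \<Longrightarrow> \<sigma> (a + b) = \<sigma> a + \<sigma> b"
    "a \<in> L \<Longrightarrow> b \<in> L \<Longrightarrow> \<sigma> (a - b) = \<sigma> a - \<sigma> b"
    "a \<in> L \<Longrightarrow> b \<in> L \<Longrightarrow> \<sigma> (a * b) = \<sigma> a * \<sigma> b"
    "a \<in> L \<Longrightarrow> \<sigma> (- a) = - \<sigma> a"
    "a \<in> L \<Longrightarrow> \<sigma> (inverse a) = inverse (\<sigma> a)"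
    "a \<in> L \<Longrightarrow> \<sigma> a = 0 \<longleftrightarrow> a = 0"
proof -
  note sf = is_subfieldD[OF assms(2)]
  have add: "\<sigma> (a + b) = \<sigma> a + \<sigma> b" and mult: "\<sigma> (a * b) = \<sigma> a * \<sigma> b" if "a \<in> L" "b \<in> L" for a b
    using assms(1) that unfolding field_emb_def by blast+
  show one: "\<sigma> 1 = 1" using assms(1) unfolding field_emb_def by blast
  show zero: "\<sigma> 0 = 0" using add[of 0 0] sf(2) by (metis add_cancel_left_left add_0)
  have neg: "\<sigma> (- a) = - \<sigma> a" if "a \<in> L" for a
    using add[of a "- a"] sf that zero by (simp add: add_eq_0_iff)
  have inv: "\<sigma> a \<noteq> 0 \<and> \<sigma> (inverse a) = inverse (\<sigma> a)" if "a \<in> L" "a \<noteq> 0" for a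
    using mult[of a "inverse a"] sf that one
    by (metis inverse_unique mult_zero_left right_inverse zero_neq_one)
  show "a \<in> L \<Longrightarrow> b \<in> L \<Longrightarrow> \<sigma> (a + b) = \<sigma> a + \<sigma> b" "a \<in> L \<Longrightarrow> b \<in> L \<Longrightarrow> \<sigma> (a * b) = \<sigma> a * \<sigma> b"
    using add mult by blast+
  show "a \<in> L \<Longrightarrow> b \<in> L \<Longrightarrow> \<sigma> (a - b) = \<sigma> a - \<sigma> b"
    using add[of a "- b"] neg sf by simp
  show "a \<in> L \<Longrightarrow> \<sigma> (- a) = - \<sigma> a" by (rule neg)
  show "a \<in> L \<Longrightarrow> \<sigma> (inverse a) = inverse (\<sigma> a)" "a \<in> L \<Longrightarrow> \<sigma> a = 0 \<longleftrightarrow> a = 0"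
    using inv zero by (cases "a = 0"; force)+
qed

lemma field_emb_power: "field_emb L \<sigma> \<Longrightarrow> is_subfield L \<Longrightarrow> a \<in> L \<Longrightarrow> \<sigma> (a ^ n) = \<sigma> a ^ n"
  by (induction n) (auto simp: field_emb_simps is_subfield_power)

lemma field_emb_powi: "field_emb L \<sigma> \<Longrightarrow> is_subfield L \<Longrightarrow> a \<in> L \<Longrightarrow> \<sigma> (a powi n) = \<sigma> a powi n"
  by (auto simp: power_int_def field_emb_simps field_emb_power is_subfieldD)

lemma field_emb_sum:
  assumes "field_emb L \<sigma>" "is_subfield L" "\<And>i. i \<in> I \<Longrightarrow> f i \<in> L"
  shows "\<sigma> (sum f I) = (\<Sum>i\<in>I. \<sigma> (f i))"
  using assms(3)
  by (induction I rule: infinite_finite_induct)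
     (auto simp: field_emb_simps[OF assms(1,2)] is_subfield_sum[OF assms(2)])

lemma field_emb_inj_on: "field_emb L \<sigma> \<Longrightarrow> is_subfield L \<Longrightarrow> inj_on \<sigma> L"
  by (rule inj_onI) (metis field_emb_simps(4,8) eq_iff_diff_eq_0 is_subfieldD(6))

lemma field_emb_eq_on_gen:
  assumes "field_emb (gen A) \<sigma>" "field_emb (gen A) \<tau>" "\<And>a. a \<in> A \<Longrightarrow> \<sigma> a = \<tau> a" "z \<in> gen A"
  shows "\<sigma> z = \<tau> z"
  using assms(4)
proof (induction rule: generate_field.induct)
  case (m_inv h)
  then show ?case
    by (simp add: field_emb_simps[OF assms(1) is_subfield_gen] field_emb_simps[OF assms(2) is_subfield_gen])
next
  case (a_inv h)
  then show ?case
    by (simp add: field_emb_simps[OF assms(1) is_subfield_gen] field_emb_simps[OF assms(2) is_subfield_gen])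
qed (simp_all add: assms(3) field_emb_simps[OF assms(1) is_subfield_gen] field_emb_simps[OF assms(2) is_subfield_gen])

lemma coeff_map_emb:
  assumes "field_emb L \<sigma>" "is_subfield L"
  shows "Polynomial.coeff (map_poly \<sigma> p) i = \<sigma> (Polynomial.coeff p i)"
  using field_emb_simps(2)[OF assms] by (simp add: coeff_map_poly)

lemma map_poly_emb:
  assumes "field_emb L \<sigma>" "is_subfield L"
  shows "poly_over L p \<Longrightarrow> poly_over L q \<Longrightarrow> map_poly \<sigma> (p + q) = map_poly \<sigma> p + map_poly \<sigma> q"
    "poly_over L p \<Longrightarrow> poly_over L q \<Longrightarrow> map_poly \<sigma> (p - q) = map_poly \<sigma> p - map_poly \<sigma> q"
    "poly_over L p \<Longrightarrow> poly_over L q \<Longrightarrow> map_poly \<sigma> (p * q) = map_poly \<sigma> p * map_poly \<sigma> q"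
    "map_poly \<sigma> (pCons a p) = pCons (\<sigma> a) (map_poly \<sigma> p)"
    "map_poly \<sigma> 1 = 1"
    "poly_over L p \<Longrightarrow> a \<in> L \<Longrightarrow> \<sigma> (poly p a) = poly (map_poly \<sigma> p) (\<sigma> a)"
    "poly_over L p \<Longrightarrow> Polynomial.degree (map_poly \<sigma> p) = Polynomial.degree p"
    "poly_over L p \<Longrightarrow> map_poly \<sigma> p = 0 \<longleftrightarrow> p = 0"
proof -
  note [simp] = coeff_map_emb[OF assms] field_emb_simps[OF assms]
  note sf [simp] = is_subfieldD[OF assms(2)]
  show "poly_over L p \<Longrightarrow> poly_over L q \<Longrightarrow> map_poly \<sigma> (p + q) = map_poly \<sigma> p + map_poly \<sigma> q"
    "poly_over L p \<Longrightarrow> poly_over L q \<Longrightarrow> map_poly \<sigma> (p - q) = map_poly \<sigma> p - map_poly \<sigma> q"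
    "poly_over L p \<Longrightarrow> poly_over L q \<Longrightarrow> map_poly \<sigma> (p * q) = map_poly \<sigma> p * map_poly \<sigma> q"
    by (rule poly_eqI; simp add: poly_over_def Polynomial.coeff_mult field_emb_sum[OF assms])+
  show pC: "map_poly \<sigma> (pCons a p) = pCons (\<sigma> a) (map_poly \<sigma> p)" for a p
    by (rule poly_eqI) (auto simp: coeff_pCons split: nat.split)
  show "map_poly \<sigma> 1 = 1"
    by (rule poly_eqI) auto
  show "poly_over L p \<Longrightarrow> a \<in> L \<Longrightarrow> \<sigma> (poly p a) = poly (map_poly \<sigma> p) (\<sigma> a)"
    by (induction p) (auto simp: pC poly_over_pCons_iff poly_in_subfield[OF assms(2)])
  show "poly_over L p \<Longrightarrow> Polynomial.degree (map_poly \<sigma> p) = Polynomial.degree p"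
    by (cases "p = 0")
       (auto intro!: antisym map_poly_degree_leq le_degree simp: poly_over_def)
  show "poly_over L p \<Longrightarrow> map_poly \<sigma> p = 0 \<longleftrightarrow> p = 0"
    by (auto simp: poly_eq_iff poly_over_def)
qed

context
begin

interpretation type_ring: field "type_ring :: 'k::field ring"
  by (rule field_from_type_algebra)

text \<open>For algebraic \<open>c\<close> the ring \<open>L[c]\<close> is already a field, so the
  inverse of \<open>p(c)\<close> is again a polynomial value at \<open>c\<close>.\<close>

lemma alg_inverse_poly:
  assumes L: "is_subfield L" and "alg L c" "poly_over L p" "poly p c \<noteq> 0"
  obtains q where "poly_over L q" "poly p c * poly q c = 1"
proof -
  let ?E = "type_ring.simple_extension L c"
  have E: "is_subfield ?E"
    using type_ring.simple_extension_is_subfield[of L c] assms(1,2)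
    by (simp add: subfield_type_ring_iff algebraic_type_ring_iff over_def)
  have im: "?E = (\<lambda>p. type_ring.eval p c) ` carrier (univ_poly type_ring L)"
    by (rule type_ring.simple_extension_as_eval_img) auto
  have "poly p c \<in> ?E"
    unfolding im using rev_coeffs_in_carrier[OF assms(3)]
    by (intro image_eqI[of _ _ "rev (coeffs p)"]) (auto simp: eval_type_ring)
  then have "inverse (poly p c) \<in> ?E"
    by (rule is_subfieldD(4)[OF E])
  then obtain r where "r \<in> carrier (univ_poly type_ring L)" "inverse (poly p c) = type_ring.eval r c"
    unfolding im by blast
  then show ?thesis
    using that[of "Poly (rev r)"] poly_over_of_carrier[OF L] assms(4)
    by (metis eval_type_ring right_inverse)
qed

end

text \<open>The equivalence \<open>iff\<close> says exactly that sending \<open>p(c)\<close> to the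
  transported polynomial at \<open>d\<close> is well defined and injective on \<open>L[c]\<close>;
  such a map extends to fractions. This form covers algebraic and transcendental \<open>c\<close>
  alike.\<close>

lemma field_emb_extend:
  fixes c :: "'k::field"
  assumes L: "is_subfield L" and \<sigma>: "field_emb L \<sigma>"
    and iff: "\<And>p. poly_over L p \<Longrightarrow> poly p c = 0 \<longleftrightarrow> poly (map_poly \<sigma> p) d = 0"
  obtains \<tau> where "field_emb (adjoin L c) \<tau>" "\<And>a. a \<in> L \<Longrightarrow> \<tau> a = \<sigma> a" "\<tau> c = d"
proof -
  note [simp] = map_poly_emb[OF \<sigma> L] field_emb_simps[OF \<sigma> L]
  note po = poly_over_intros[OF L]
  define R where "R z pq \<longleftrightarrow> poly_over L (fst pq) \<and> poly_over L (snd pq) \<and>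
      poly (snd pq) c \<noteq> 0 \<and> z = poly (fst pq) c / poly (snd pq) c" for z pq
  \<comment> \<open>One representation with nonvanishing denominator is selected;
    cross-multiplication in \<open>\<tau>_eq\<close> shows that the value does not depend on
    it.\<close>
  define \<tau> where "\<tau> z = (let pq = (SOME pq. R z pq)
      in poly (map_poly \<sigma> (fst pq)) d / poly (map_poly \<sigma> (snd pq)) d)" for z
  have \<tau>_eq: "\<tau> (poly p c / poly q c) = poly (map_poly \<sigma> p) d / poly (map_poly \<sigma> q) d"
    if p: "poly_over L p" and q: "poly_over L q" "poly q c \<noteq> 0" for p q
  proof -
    define z where "z = poly p c / poly q c"
    obtain p' q' where pq': "(SOME pq. R z pq) = (p', q')" by (meson surj_pair)
    have "R z (p', q')"
      unfolding pq'[symmetric] by (rule someI[of _ "(p, q)"]) (simp add: R_def that z_def)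
    then have R: "poly_over L p'" "poly_over L q'" "poly q' c \<noteq> 0" "z = poly p' c / poly q' c"
      by (simp_all add: R_def)
    have nz: "poly (map_poly \<sigma> q) d \<noteq> 0" "poly (map_poly \<sigma> q') d \<noteq> 0"
      using iff q R by blast+
    have "poly (p * q' - p' * q) c = 0"
      using R q by (simp add: z_def field_simps)
    then have "poly (map_poly \<sigma> (p * q' - p' * q)) d = 0"
      using iff[OF po(7)[OF po(8)[OF p R(2)] po(8)[OF R(1) q(1)]]] by blast
    then have "poly (map_poly \<sigma> p) d * poly (map_poly \<sigma> q') d =
        poly (map_poly \<sigma> p') d * poly (map_poly \<sigma> q) d"
      using p q R po(8) by simp
    then show ?thesis
      using nz by (simp add: \<tau>_def pq' z_def[symmetric] frac_eq_eq)
  qed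
  have rep: "\<exists>p q. poly_over L p \<and> poly_over L q \<and> poly q c \<noteq> 0 \<and> z = poly p c / poly q c"
    if z: "z \<in> adjoin L c" for z
  proof -
    obtain p q where pq: "poly_over L p" "poly_over L q" "z = poly p c / poly q c"
      using z unfolding adjoin_def by blast
    show ?thesis
    proof (cases "poly q c = 0")
      case True
      then have "z = poly 0 c / poly 1 c" using pq by simp
      then show ?thesis using po(1,2) by (metis poly_1 zero_neq_one)
    qed (use pq in blast)
  qed
  have \<tau>L: "\<tau> a = \<sigma> a" if "a \<in> L" for a
    using \<tau>_eq[of "[:a:]" 1] po(1,2,3) that by simp
  have "field_emb (adjoin L c) \<tau>"
    unfolding field_emb_def
  proof (intro conjI ballI)
    show "\<tau> 1 = 1"
      using \<tau>L[OF is_subfieldD(1)[OF L]] by simp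
  next
    fix a b assume "a \<in> adjoin L c" "b \<in> adjoin L c"
    then obtain p q p' q' where a: "poly_over L p" "poly_over L q" "poly q c \<noteq> 0" "a = poly p c / poly q c"
      and b: "poly_over L p'" "poly_over L q'" "poly q' c \<noteq> 0" "b = poly p' c / poly q' c"
      using rep by meson
    have nz: "poly (map_poly \<sigma> q) d \<noteq> 0" "poly (map_poly \<sigma> q') d \<noteq> 0"
      using iff a b by blast+
    have qq: "poly_over L (q * q')" "poly (q * q') c \<noteq> 0"
      using a b po(8) by auto
    have "a + b = poly (p * q' + p' * q) c / poly (q * q') c"
      using a b by (simp add: add_frac_eq)
    then have "\<tau> (a + b) = poly (map_poly \<sigma> (p * q' + p' * q)) d / poly (map_poly \<sigma> (q * q')) d"
      using \<tau>_eq[OF po(6)[OF po(8)[OF a(1) b(2)] po(8)[OF b(1) a(2)]] qq] by simp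
    then show "\<tau> (a + b) = \<tau> a + \<tau> b"
      using a b nz po(8) \<tau>_eq[of p q] \<tau>_eq[of p' q'] by (simp add: add_frac_eq)
    have "a * b = poly (p * p') c / poly (q * q') c"
      using a b by simp
    then have "\<tau> (a * b) = poly (map_poly \<sigma> (p * p')) d / poly (map_poly \<sigma> (q * q')) d"
      using \<tau>_eq[OF po(8)[OF a(1) b(1)] qq] by simp
    then show "\<tau> (a * b) = \<tau> a * \<tau> b"
      using a b \<tau>_eq[of p q] \<tau>_eq[of p' q'] by simp
  qed
  moreover have "\<tau> c = d"
    using \<tau>_eq[of "[:0, 1:]" 1] po(1,2,3) is_subfieldD(1,2)[OF L] by simp
  ultimately show ?thesis
    using that \<tau>L by blast
qed

text \<open>For algebraic \<open>c\<close> one implication gives the other: if \<open>p(c)\<close>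
  is nonzero with inverse \<open>q(c)\<close>, then \<open>p q - 1\<close> vanishes at
  \<open>c\<close>, so its transport vanishes at \<open>d\<close>. A zero of the transported
  \<open>p\<close> at \<open>d\<close> would then give \<open>- 1 = 0\<close>.\<close>

lemma alg_specialization_iff:
  assumes L: "is_subfield L" and \<sigma>: "field_emb L \<sigma>" and "alg L c"
    and imp: "\<And>p. poly_over L p \<Longrightarrow> poly p c = 0 \<Longrightarrow> poly (map_poly \<sigma> p) d = 0"
    and p: "poly_over L p"
  shows "poly p c = 0 \<longleftrightarrow> poly (map_poly \<sigma> p) d = 0"
proof
  assume d: "poly (map_poly \<sigma> p) d = 0"
  show "poly p c = 0"
  proof (rule ccontr)
    assume "poly p c \<noteq> 0"
    then obtain q where q: "poly_over L q" "poly p c * poly q c = 1"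
      using alg_inverse_poly[OF L assms(3) p] by blast
    have "poly_over L (p * q)" "poly_over L (p * q - 1)"
      using poly_over_intros[OF L] p q by blast+
    then have "poly (map_poly \<sigma> (p * q - 1)) d = 0"
      using imp[of "p * q - 1"] q(2) by simp
    moreover have "map_poly \<sigma> (p * q - 1) = map_poly \<sigma> p * map_poly \<sigma> q - 1"
      using map_poly_emb(2)[OF \<sigma> L \<open>poly_over L (p * q)\<close> poly_over_intros(2)[OF L]]
        map_poly_emb(3)[OF \<sigma> L p q(1)] map_poly_emb(5)[OF \<sigma> L] by simp
    ultimately show False
      using d by simp
  qed
next
  assume "poly p c = 0"
  then show "poly (map_poly \<sigma> p) d = 0"
    using imp p by blast
qed

text \<open>Any root \<open>d\<close> of the transported minimal polynomial is an admissible image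
  of \<open>c\<close>, and algebraic closedness supplies one.\<close>

lemma field_emb_extend_alg:
  fixes c :: "'k::field"
  assumes closed: "alg_closed TYPE('k)" and L: "is_subfield L" and \<sigma>: "field_emb L \<sigma>" and c: "alg L c"
  obtains \<tau> where "field_emb (adjoin L c) \<tau>" "\<And>a. a \<in> L \<Longrightarrow> \<tau> a = \<sigma> a"
proof -
  obtain m where m: "poly_over L m" "Polynomial.degree m > 0"
    "\<And>p. poly_over L p \<Longrightarrow> poly p c = 0 \<Longrightarrow> \<exists>q. poly_over L q \<and> p = m * q"
    by (rule minimal_poly_exists[OF L c]) blast
  obtain d where d: "poly (map_poly \<sigma> m) d = 0"
    using closed m(1,2) map_poly_emb(7)[OF \<sigma> L m(1)] unfolding alg_closed_def by metis
  have imp: "poly (map_poly \<sigma> p) d = 0" if "poly_over L p" "poly p c = 0" for p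
    using m(3)[OF that] d m(1) by (auto simp: map_poly_emb(3)[OF \<sigma> L])
  show ?thesis
    using field_emb_extend[OF L \<sigma> alg_specialization_iff[OF L \<sigma> c imp]] that by blast
qed

text \<open>Elements are adjoined one at a time, so no appeal to Zorn's lemma is made; finitely many
  suffice because the fields to be covered are finitely generated over \<open>L\<close>.\<close>

lemma field_emb_extend_finite:
  fixes L :: "'k::field set"
  assumes closed: "alg_closed TYPE('k)" and "finite A"
    and L: "is_subfield L" and \<sigma>: "field_emb L \<sigma>" and "\<And>a. a \<in> A \<Longrightarrow> alg L a"
  shows "\<exists>L' \<tau>. is_subfield L' \<and> L \<subseteq> L' \<and> A \<subseteq> L' \<and> field_emb L' \<tau> \<and> (\<forall>a\<in>L. \<tau> a = \<sigma> a)"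
  using assms(2,5)
proof (induction A rule: finite_induct)
  case empty
  then show ?case using L \<sigma> by blast
next
  case (insert c A)
  then obtain L' \<tau> where L': "is_subfield L'" "L \<subseteq> L'" "A \<subseteq> L'" "field_emb L' \<tau>" "\<forall>a\<in>L. \<tau> a = \<sigma> a"
    by blast
  have "alg L' c" using insert.prems L'(2) alg_mono by blast
  then obtain \<tau>' where \<tau>': "field_emb (adjoin L' c) \<tau>'" "\<And>a. a \<in> L' \<Longrightarrow> \<tau>' a = \<tau> a"
    using field_emb_extend_alg[OF closed L'(1,4)] by blast
  have "L' \<union> {c} \<subseteq> adjoin L' c" "is_subfield (adjoin L' c)"
    using gen_incl[of "L' \<union> {c}"] is_subfield_gen[of "L' \<union> {c}"] by (simp_all add: adjoin_eq_gen[OF L'(1)])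
  then show ?case
    using L' \<tau>' by (intro exI[of _ "adjoin L' c"] exI[of _ \<tau>']) auto
qed

section \<open>Conjugates\<close>

text \<open>Conjugacy is phrased without a minimal polynomial. It is one-sided in form, but
  symmetric for algebraic \<open>a\<close> by \<open>conjugate_sym\<close>.\<close>

definition conjugate :: "'k::field set \<Rightarrow> 'k \<Rightarrow> 'k \<Rightarrow> bool" where
  "conjugate L a b \<longleftrightarrow> (\<forall>p. poly_over L p \<longrightarrow> poly p a = 0 \<longrightarrow> poly p b = 0)"

lemma map_poly_fixed:
  assumes "\<And>z. z \<in> L \<Longrightarrow> \<tau> z = z" "is_subfield L" "poly_over L p"
  shows "map_poly \<tau> p = p"
  using assms by (intro poly_eqI) (auto simp: coeff_map_poly poly_over_def is_subfieldD(2))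

lemma field_emb_conjugate:
  assumes "is_subfield L" "is_subfield L'" "field_emb L' \<tau>" "L \<subseteq> L'" "\<And>z. z \<in> L \<Longrightarrow> \<tau> z = z" "c \<in> L'"
  shows "conjugate L c (\<tau> c)"
  unfolding conjugate_def
proof (intro allI impI)
  fix p assume p: "poly_over L p" "poly p c = 0"
  have "poly (map_poly \<tau> p) (\<tau> c) = \<tau> 0"
    using map_poly_emb(6)[OF assms(3,2) poly_over_mono[OF p(1) assms(4)] assms(6)] p(2) by simp
  then show "poly p (\<tau> c) = 0"
    using map_poly_fixed[OF assms(5,1) p(1)] field_emb_simps(2)[OF assms(3,2)] by simp
qed

lemma field_emb_id: "field_emb L (\<lambda>z. z)"
  unfolding field_emb_def by simp

lemma conjugate_sym:
  assumes "is_subfield L" "alg L a" "conjugate L a b"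
  shows "conjugate L b a"
  using alg_specialization_iff[OF assms(1) field_emb_id assms(2), of b] assms(3)
  unfolding conjugate_def by (simp add: map_poly_idI)

text \<open>Conjugacy gives an embedding of \<open>L(a)\<close> sending \<open>a\<close> to
  \<open>b\<close>; it is then extended over the finite set \<open>A\<close>. With \<open>A\<close>
  generating a field \<open>M\<close> over \<open>L\<close>, the result is an embedding of
  \<open>M\<close> with a prescribed conjugate as value.\<close>

lemma conjugate_extend:
  fixes L :: "'k::field set"
  assumes closed: "alg_closed TYPE('k)" and A: "finite A" and L: "is_subfield L"
    and al: "\<And>z. alg L z" and ab: "conjugate L a b"
  obtains L' \<tau> where "is_subfield L'" "L \<subseteq> L'" "A \<subseteq> L'" "a \<in> L'" "field_emb L' \<tau>"
    "\<And>z. z \<in> L \<Longrightarrow> \<tau> z = z" "\<tau> a = b"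
proof -
  have "poly p a = 0 \<longleftrightarrow> poly (map_poly (\<lambda>z. z) p) b = 0" if "poly_over L p" for p
    by (rule alg_specialization_iff[OF L field_emb_id al _ that])
       (use ab in \<open>auto simp: conjugate_def map_poly_idI\<close>)
  then obtain \<sigma> where \<sigma>: "field_emb (adjoin L a) \<sigma>" "\<And>z. z \<in> L \<Longrightarrow> \<sigma> z = z" "\<sigma> a = b"
    using field_emb_extend[OF L field_emb_id, of a b] by blast
  have La: "L \<union> {a} \<subseteq> adjoin L a" "is_subfield (adjoin L a)"
    using gen_incl[of "L \<union> {a}"] is_subfield_gen[of "L \<union> {a}"] by (simp_all add: adjoin_eq_gen[OF L])
  obtain L' \<tau> where "is_subfield L'" "adjoin L a \<subseteq> L'" "A \<subseteq> L'" "field_emb L' \<tau>" "\<forall>z\<in>adjoin L a. \<tau> z = \<sigma> z"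
    using field_emb_extend_finite[OF closed A La(2) \<sigma>(1)] alg_mono[OF al] La(1) by blast
  then show ?thesis
    using that[of L' \<tau>] La(1) \<sigma>(2,3) by (metis Un_iff insertI1 subset_eq)
qed

text \<open>The type \<open>'k\<close> is only assumed to be a field, so characteristic zero is a
  separate property; it will come from the embedded complex numbers.\<close>

definition char_zero :: "'k::field itself \<Rightarrow> bool" where
  "char_zero _ \<longleftrightarrow> (\<forall>n>0. of_nat n \<noteq> (0 :: 'k))"

text \<open>In characteristic zero the derivative of \<open>m\<close> is nonzero and of smaller
  degree. If it vanished at the conjugate \<open>r\<close>, it would vanish at \<open>a\<close> by
  symmetry of conjugacy, against minimality.\<close>

lemma minimal_poly_simple_roots:
  fixes L :: "'k::field set"
  assumes "char_zero TYPE('k)" and L: "is_subfield L" and "alg L a"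
    and m: "poly_over L m" "poly m a = 0" "Polynomial.degree m > 0"
    and min: "\<And>p. poly_over L p \<Longrightarrow> poly p a = 0 \<Longrightarrow> p \<noteq> 0 \<Longrightarrow> Polynomial.degree m \<le> Polynomial.degree p"
    and r: "conjugate L a r"
  shows "poly (pderiv m) r \<noteq> 0"
proof
  assume "poly (pderiv m) r = 0"
  then have "poly (pderiv m) a = 0"
    using conjugate_sym[OF L assms(3) r] poly_over_pderiv[OF L m(1)] unfolding conjugate_def by blast
  moreover have "Polynomial.coeff (pderiv m) (Polynomial.degree m - 1) \<noteq> 0"
    using assms(1) m(3) unfolding coeff_pderiv char_zero_def
    by (metis Suc_diff_1 degree_0 leading_coeff_0_iff mult_eq_0_iff not_less0)
  then have "pderiv m \<noteq> 0" by auto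
  ultimately have "Polynomial.degree m \<le> Polynomial.degree (pderiv m)"
    using min poly_over_pderiv[OF L m(1)] by blast
  moreover have "Polynomial.degree (pderiv m) \<le> Polynomial.degree m - 1"
    by (rule Polynomial.degree_le) (auto simp: coeff_pderiv coeff_eq_0)
  ultimately show False using m(3) by linarith
qed

text \<open>Removing the factor \<open>X - a\<close> from the minimal polynomial leaves a
  nonconstant cofactor, since \<open>a\<close> is not in \<open>L\<close>. A root of the cofactor is
  a conjugate, and it differs from \<open>a\<close> because \<open>a\<close> is a simple
  root.\<close>

lemma other_conjugate_exists:
  fixes L :: "'k::field set"
  assumes "alg_closed TYPE('k)" "char_zero TYPE('k)" and L: "is_subfield L" and a: "alg L a" "a \<notin> L"
  obtains b where "b \<noteq> a" "conjugate L a b"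
proof -
  obtain m where m: "poly_over L m" "poly m a = 0" "Polynomial.degree m > 0"
    "\<And>p. poly_over L p \<Longrightarrow> poly p a = 0 \<Longrightarrow> \<exists>q. poly_over L q \<and> p = m * q"
    "\<And>p. poly_over L p \<Longrightarrow> poly p a = 0 \<Longrightarrow> p \<noteq> 0 \<Longrightarrow> Polynomial.degree m \<le> Polynomial.degree p"
    by (rule minimal_poly_exists[OF L a(1)]) blast
  obtain q where q: "m = [:-a, 1:] * q"
    using m(2) by (metis dvdE poly_eq_0_iff_dvd)
  have "Polynomial.degree q > 0"
  proof (rule ccontr)
    assume "\<not> Polynomial.degree q > 0"
    then obtain e where e: "q = [:e:]" by (auto elim: degree_eq_zeroE)
    have "m = [:- a * e, e:]" by (simp add: q e)
    then have "- a * e \<in> L" "e \<in> L" "e \<noteq> 0"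
      using m(1,3) by (auto simp: poly_over_pCons_iff)
    then have "- ((- a * e) / e) \<in> L"
      by (intro is_subfieldD(3,8)[OF L])
    then show False using a(2) \<open>e \<noteq> 0\<close> by simp
  qed
  then obtain b where b: "poly q b = 0"
    using assms(1) unfolding alg_closed_def by blast
  then have "poly m b = 0" by (simp add: q)
  then have conj: "conjugate L a b"
    unfolding conjugate_def using m(4) by fastforce
  have "b \<noteq> a"
  proof
    assume "b = a"
    then have "poly (pderiv m) a = 0"
      using b unfolding q pderiv_mult by (simp add: pderiv_pCons)
    moreover have "conjugate L a a" by (simp add: conjugate_def)
    ultimately show False
      using minimal_poly_simple_roots[OF assms(2) L a(1) m(1,2,3,5)] by blast
  qed
  then show ?thesis using that conj by blast
qed

lemma char_zero_infinite:
  assumes "char_zero TYPE('k::field)"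
  shows "infinite (UNIV :: 'k set)"
proof -
  have "inj (of_nat :: nat \<Rightarrow> 'k)"
  proof (rule linorder_injI)
    fix m n :: nat assume "m < n"
    then have "of_nat (n - m) \<noteq> (0 :: 'k)"
      using assms unfolding char_zero_def by (metis zero_less_diff)
    then show "of_nat m \<noteq> (of_nat n :: 'k)"
      using \<open>m < n\<close> by (simp add: of_nat_diff)
  qed
  then have "infinite (range (of_nat :: nat \<Rightarrow> 'k))"
    using range_inj_infinite by blast
  then show ?thesis
    by (rule infinite_super[OF subset_UNIV])
qed

section \<open>Normality and separability in terms of conjugates\<close>

context
begin

interpretation type_ring: field "type_ring :: 'k::field ring"
  by (rule field_from_type_algebra)

text \<open>\<open>Irr\<close> divides every polynomial over \<open>L\<close> that vanishes at
  \<open>a\<close>, and it is itself one of these. Its roots are therefore the conjugates, which is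
  what embeddings can handle.\<close>

lemma eval_Irr_iff_conjugate:
  assumes L: "is_subfield L" and a: "alg L a"
  shows "type_ring.eval (type_ring.Irr L a) b = 0 \<longleftrightarrow> conjugate L a b"
proof -
  have sL: "subfield L type_ring" and al: "(type_ring.algebraic over L) a"
    using assms by (simp_all add: subfield_type_ring_iff algebraic_type_ring_iff over_def)
  note I = type_ring.IrrE[OF sL _ al, simplified]
  show ?thesis
  proof
    assume b: "type_ring.eval (type_ring.Irr L a) b = 0"
    show "conjugate L a b"
      unfolding conjugate_def
    proof (intro allI impI)
      fix p assume p: "poly_over L p" "poly p a = 0"
      have "(type_ring.Irr L a) pdivides\<^bsub>type_ring\<^esub> (rev (coeffs p))"
        using type_ring.Irr_minimal[OF sL _ al rev_coeffs_in_carrier[OF p(1)]] p(2)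
        by (simp add: eval_type_ring)
      then have "type_ring.eval (rev (coeffs p)) b = 0"
        using type_ring.pdivides_imp_root_sharing[OF type_ring.carrier_polynomial_shell[OF subfieldE(1)[OF sL] I(1)]] b
        by simp
      then show "poly p b = 0" by (simp add: eval_type_ring)
    qed
  next
    assume "conjugate L a b"
    then show "type_ring.eval (type_ring.Irr L a) b = 0"
      using I(4) poly_over_of_carrier[OF L I(1)] unfolding conjugate_def by (simp add: eval_type_ring)
  qed
qed

text \<open>If all conjugates lie in \<open>M\<close>, an irreducible factor over \<open>M\<close>
  has a root in \<open>M\<close> and hence degree one. Conversely, a conjugate \<open>b\<close> has
  an irreducible polynomial over \<open>M\<close> dividing the split one; it is linear, so
  \<open>b\<close> is a quotient of elements of \<open>M\<close>.\<close>

lemma splitted_Irr_iff: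
  fixes L :: "'k::field set"
  assumes closed: "alg_closed TYPE('k)" and L: "is_subfield L" and M: "is_subfield M" and "L \<subseteq> M"
    and a: "alg L a"
  shows "ring.splitted (type_ring\<lparr>carrier := M\<rparr>) (type_ring.Irr L a) \<longleftrightarrow> (\<forall>b. conjugate L a b \<longrightarrow> b \<in> M)"
proof -
  have sL: "subfield L type_ring" and sM: "subfield M type_ring" and al: "(type_ring.algebraic over L) a"
    using assms by (simp_all add: subfield_type_ring_iff algebraic_type_ring_iff over_def)
  interpret M: field "type_ring\<lparr>carrier := M\<rparr>"
    by (rule type_ring.subfield_iff(2)[OF sM])
  note rM = subfieldE(1)[OF sM]
  note I = type_ring.IrrE[OF sL _ al, simplified]
  let ?I = "type_ring.Irr L a"
  have uc: "univ_poly (type_ring\<lparr>carrier := M\<rparr>) = univ_poly type_ring"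
    by (rule type_ring.univ_poly_consistent[OF rM])
  have ev: "M.eval = type_ring.eval"
    by (rule type_ring.eval_consistent[OF rM])
  have IM: "?I \<in> carrier (univ_poly type_ring M)"
    using I(1) \<open>L \<subseteq> M\<close> by (auto simp: univ_poly_carrier[symmetric] polynomial_def)
  \<comment> \<open>Restricting the carrier restricts the admissible cofactors; for polynomials over
    the subfield \<open>M\<close> this does not affect divisibility.\<close>
  have pd: "p pdivides\<^bsub>type_ring\<lparr>carrier := M\<rparr>\<^esub> q \<longleftrightarrow> p pdivides\<^bsub>type_ring\<^esub> q"
    if "p \<in> carrier (univ_poly type_ring M)" "q \<in> carrier (univ_poly type_ring M)" for p q
    using type_ring.pdivides_iff_shell[OF sM that] by (simp add: pdivides_def uc)
  have I0: "?I \<noteq> []"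
    using type_ring.pirreducible_degree[OF sL I(1,2)] by auto
  show ?thesis
  proof
    assume "\<forall>b. conjugate L a b \<longrightarrow> b \<in> M"
    then have roots: "b \<in> M" if "type_ring.eval ?I b = 0" for b
      using that eval_Irr_iff_conjugate[OF L a] by blast
    show "M.splitted ?I"
    proof (rule M.trivial_factors_imp_splitted)
      show "?I \<in> carrier (poly_ring (type_ring\<lparr>carrier := M\<rparr>))"
        using IM by (simp add: uc)
    next
      fix q assume q: "q \<in> carrier (poly_ring (type_ring\<lparr>carrier := M\<rparr>))"
        "pirreducible\<^bsub>type_ring\<lparr>carrier := M\<rparr>\<^esub> (carrier (type_ring\<lparr>carrier := M\<rparr>)) q"
        "q pdivides\<^bsub>type_ring\<lparr>carrier := M\<rparr>\<^esub> ?I"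
      have qM: "q \<in> carrier (univ_poly type_ring M)" using q(1) by (simp add: uc)
      have deg: "Polynomials.degree q \<ge> 1"
        using type_ring.pirreducible_degree[OF sM qM] q(2) by (simp add: uc)
      have "Polynomial.degree (Poly (rev q)) > 0"
      proof -
        obtain u us where us: "q = u # us" using deg by (cases q) auto
        then have "u \<noteq> 0" "length us > 0"
          using qM deg by (auto simp: univ_poly_carrier[symmetric] polynomial_def)
        moreover have "Polynomial.coeff (Poly (rev q)) (length us) = u"
          by (simp add: us nth_default_append)
        ultimately show ?thesis using le_degree by (metis less_le_trans)
      qed
      then obtain r where r: "poly (Poly (rev q)) r = 0"
        using closed unfolding alg_closed_def by blast
      then have "type_ring.eval q r = 0" by (simp add: eval_type_ring)
      moreover have "q pdivides\<^bsub>type_ring\<^esub> ?I" using q(3) pd[OF qM IM] by blast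
      ultimately have "type_ring.eval ?I r = 0"
        using type_ring.pdivides_imp_root_sharing[OF type_ring.carrier_polynomial_shell[OF rM qM]] by simp
      then have "r \<in> M" by (rule roots)
      then have "M.is_root q r"
        using \<open>type_ring.eval q r = 0\<close> deg by (auto simp: M.is_root_def ev)
      then have "r \<in># M.roots q"
        using M.roots_mem_iff_is_root[OF q(1)] by blast
      then have "Polynomials.degree q = 1"
        using M.pirreducible_roots[OF q(1,2)] by force
      then show "Polynomials.degree q \<le> 1" by simp
    qed
  next
    assume sp: "M.splitted ?I"
    show "\<forall>b. conjugate L a b \<longrightarrow> b \<in> M"
    proof (intro allI impI)
      fix b assume "conjugate L a b"
      then have b: "type_ring.eval ?I b = 0" using eval_Irr_iff_conjugate[OF L a] by blast
      then have alb: "(type_ring.algebraic over M) b"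
        using type_ring.algebraicI[OF IM I0] by simp
      note J = type_ring.IrrE[OF sM _ alb, simplified]
      let ?J = "type_ring.Irr M b"
      have "?J pdivides\<^bsub>type_ring\<^esub> ?I"
        using type_ring.Irr_minimal[OF sM _ alb IM] b by simp
      then have "Polynomials.degree ?J = 1"
        using M.splitted_imp_trivial_factors[of ?I ?J] IM I0 sp J(1,2) pd[OF J(1) IM] by (simp add: uc)
      then have "length ?J = Suc (Suc 0)" by linarith
      then obtain u v where uv: "?J = [u, v]"
        by (auto simp: length_Suc_conv)
      then have "u \<in> M" "v \<in> M" "u \<noteq> 0" "u * b + v = 0"
        using J(1,4) by (auto simp: univ_poly_carrier[symmetric] polynomial_def)
      then have "b = - (v / u)"
        by (simp add: field_simps add_eq_0_iff)
      then show "b \<in> M"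
        using is_subfieldD(3,8)[OF M] \<open>u \<in> M\<close> \<open>v \<in> M\<close> by simp
    qed
  qed
qed

lemma normal_ext_iff:
  fixes L :: "'k::field set"
  assumes "alg_closed TYPE('k)" "is_subfield L" "is_subfield M" "L \<subseteq> M"
  shows "normal_ext type_ring L M \<longleftrightarrow> (\<forall>a\<in>M. alg L a \<and> (\<forall>b. conjugate L a b \<longrightarrow> b \<in> M))"
  unfolding normal_ext_def algebraic_type_ring_iff[OF assms(2)]
  using splitted_Irr_iff[OF assms] by blast

text \<open>Evaluation is multiplicative on both sides, so the two polynomials agree at every point;
  in characteristic zero there are infinitely many points, which forces equality.\<close>

lemma Poly_rev_mult:
  fixes p q :: "'k::field list"
  assumes "char_zero TYPE('k)"
    and p: "p \<in> carrier (poly_ring type_ring)" and q: "q \<in> carrier (poly_ring type_ring)"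
  shows "Poly (rev (p \<otimes>\<^bsub>poly_ring type_ring\<^esub> q)) = Poly (rev p) * Poly (rev q)"
proof -
  have "poly (Poly (rev (p \<otimes>\<^bsub>poly_ring type_ring\<^esub> q))) z = poly (Poly (rev p) * Poly (rev q)) z" for z
  proof -
    interpret ev: ring_hom_cring "univ_poly type_ring UNIV" type_ring "\<lambda>p. type_ring.eval p z"
      using type_ring.eval_cring_hom[OF type_ring.carrier_is_subring, of z] by simp
    show ?thesis
      using ev.hom_mult[of p q] p q by (simp add: eval_type_ring)
  qed
  then have "infinite {z. poly (Poly (rev (p \<otimes>\<^bsub>poly_ring type_ring\<^esub> q)) - Poly (rev p) * Poly (rev q)) z = 0}"
    using char_zero_infinite[OF assms(1)] by simp
  then show ?thesis
    using poly_roots_finite by (metis eq_iff_diff_eq_0)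
qed

text \<open>A root of multiplicity two would give a square factor of \<open>Irr\<close>, hence of
  the minimal polynomial \<open>m\<close> that \<open>Irr\<close> divides. The derivative of
  \<open>m\<close> would then vanish at a conjugate.\<close>

lemma separable_ext_char_zero:
  fixes L :: "'k::field set"
  assumes char: "char_zero TYPE('k)" and L: "is_subfield L" and "\<And>a. a \<in> M \<Longrightarrow> alg L a"
  shows "separable_ext type_ring L M"
  unfolding separable_ext_def algebraic_type_ring_iff[OF L]
proof (intro ballI conjI)
  fix a assume "a \<in> M"
  then show a: "alg L a" by (rule assms(3))
  fix r :: 'k
  interpret UP: domain "univ_poly type_ring (UNIV :: 'k set)"
    using type_ring.univ_poly_is_domain[OF type_ring.carrier_is_subring] by simp
  have sL: "subfield L type_ring" and al: "(type_ring.algebraic over L) a"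
    using L a by (simp_all add: subfield_type_ring_iff algebraic_type_ring_iff over_def)
  note I = type_ring.IrrE[OF sL _ al, simplified]
  let ?I = "type_ring.Irr L a"
  have IK: "?I \<in> carrier (poly_ring type_ring)"
    using type_ring.carrier_polynomial_shell[OF subfieldE(1)[OF sL] I(1)] .
  show "type_ring.alg_mult ?I r \<le> 1"
  proof (rule ccontr)
    assume "\<not> type_ring.alg_mult ?I r \<le> 1"
    then have "2 \<le> type_ring.alg_mult ?I r" by simp
    from type_ring.le_alg_mult_imp_pdivides[OF _ IK this]
    have "([1, - r] [^]\<^bsub>poly_ring type_ring\<^esub> (2::nat)) pdivides\<^bsub>type_ring\<^esub> ?I" by simp
    then obtain q where q: "q \<in> carrier (poly_ring type_ring)"
      "?I = ([1, - r] [^]\<^bsub>poly_ring type_ring\<^esub> (2::nat)) \<otimes>\<^bsub>poly_ring type_ring\<^esub> q"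
      unfolding pdivides_def factor_def by blast
    have lin: "[1, - r] \<in> carrier (poly_ring type_ring)"
      by (auto simp: univ_poly_carrier[symmetric] polynomial_def)
    have "[1, - r] [^]\<^bsub>poly_ring type_ring\<^esub> (2::nat) = [1, - r] \<otimes>\<^bsub>poly_ring type_ring\<^esub> [1, - r]"
      using lin by (simp add: numeral_2_eq_2 UP.nat_pow_Suc)
    then have eq: "Poly (rev ?I) = [:- r, 1:] * [:- r, 1:] * Poly (rev q)"
      using Poly_rev_mult[OF char _ q(1)] Poly_rev_mult[OF char lin lin] lin
      by (simp add: q(2))
    obtain m where m: "poly_over L m" "poly m a = 0" "Polynomial.degree m > 0"
      "\<And>p. poly_over L p \<Longrightarrow> poly p a = 0 \<Longrightarrow> \<exists>q. poly_over L q \<and> p = m * q"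
      "\<And>p. poly_over L p \<Longrightarrow> poly p a = 0 \<Longrightarrow> p \<noteq> 0 \<Longrightarrow> Polynomial.degree m \<le> Polynomial.degree p"
      by (rule minimal_poly_exists[OF L a]) blast
    have root: "poly (Poly (rev ?I)) r = 0" by (simp add: eq)
    then have conj: "conjugate L a r"
      using eval_Irr_iff_conjugate[OF L a] by (simp add: eval_type_ring)
    have "?I pdivides\<^bsub>type_ring\<^esub> (rev (coeffs m))"
      using type_ring.Irr_minimal[OF sL _ al rev_coeffs_in_carrier[OF m(1)]] m(2)
      by (simp add: eval_type_ring)
    then obtain s where s: "s \<in> carrier (poly_ring type_ring)"
      "rev (coeffs m) = ?I \<otimes>\<^bsub>poly_ring type_ring\<^esub> s"
      unfolding pdivides_def factor_def by blast
    have "m = Poly (rev ?I) * Poly (rev s)"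
      using Poly_rev_mult[OF char IK s(1)] s(2) by (metis Poly_coeffs rev_rev_ident)
    then have m_eq: "m = [:- r, 1:] * ([:- r, 1:] * (Poly (rev q) * Poly (rev s)))"
      by (simp only: eq mult.assoc)
    have "poly (pderiv m) r = 0"
      unfolding m_eq pderiv_mult by simp
    then show False
      using minimal_poly_simple_roots[OF char L a m(1,2,3,5) conj] by blast
  qed
qed

end

section \<open>Automorphism groups\<close>

lemma ring_auto_iff:
  assumes M: "is_subfield M"
  shows "\<sigma> \<in> ring_auto (type_ring\<lparr>carrier := M\<rparr>) \<longleftrightarrow> field_emb M \<sigma> \<and> \<sigma> \<in> Bij M"
  using Bij_imp_funcset[of \<sigma> M]
  by (auto simp: ring_auto_def ring_hom_def field_emb_def is_subfieldD[OF M])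

lemma Gal_iff:
  assumes M: "is_subfield M"
  shows "\<sigma> \<in> Gal type_ring M L \<longleftrightarrow> field_emb M \<sigma> \<and> \<sigma> \<in> Bij M \<and> (\<forall>a\<in>L. \<sigma> a = a)"
  by (auto simp: Gal_def ring_auto_iff[OF M])

text \<open>Viewing the automorphisms of \<open>M\<close> inside \<open>BijGroup M\<close> lets the
  group structure and the formula for inverses be inherited.\<close>

lemma subgroup_field_auts:
  assumes M: "is_subfield M"
  shows "subgroup {\<sigma>. field_emb M \<sigma> \<and> \<sigma> \<in> Bij M} (BijGroup M)"
proof (rule subgroup.intro)
  show "{\<sigma>. field_emb M \<sigma> \<and> \<sigma> \<in> Bij M} \<subseteq> carrier (BijGroup M)"
    by (auto simp: BijGroup_def)
next
  fix \<sigma> \<tau> assume "\<sigma> \<in> {\<sigma>. field_emb M \<sigma> \<and> \<sigma> \<in> Bij M}" "\<tau> \<in> {\<sigma>. field_emb M \<sigma> \<and> \<sigma> \<in> Bij M}"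
  then show "\<sigma> \<otimes>\<^bsub>BijGroup M\<^esub> \<tau> \<in> {\<sigma>. field_emb M \<sigma> \<and> \<sigma> \<in> Bij M}"
    using Bij_imp_funcset[of \<tau> M]
    by (auto simp: BijGroup_def compose_Bij field_emb_def compose_eq is_subfieldD[OF M] Pi_iff)
next
  show "\<one>\<^bsub>BijGroup M\<^esub> \<in> {\<sigma>. field_emb M \<sigma> \<and> \<sigma> \<in> Bij M}"
    by (auto simp: BijGroup_def id_Bij field_emb_def is_subfieldD[OF M])
next
  fix \<sigma> assume \<sigma>: "\<sigma> \<in> {\<sigma>. field_emb M \<sigma> \<and> \<sigma> \<in> Bij M}"
  then have "inv\<^bsub>BijGroup M\<^esub> \<sigma> = (\<lambda>z\<in>M. inv_into M \<sigma> z)" "\<sigma> \<in> Bij M" and emb: "field_emb M \<sigma>"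
    by (simp_all add: inv_BijGroup)
  moreover have "field_emb M (\<lambda>z\<in>M. inv_into M \<sigma> z)"
    unfolding field_emb_def
  proof (intro conjI ballI)
    have inj: "inj_on \<sigma> M" using \<open>\<sigma> \<in> Bij M\<close> by (simp add: Bij_def bij_betw_def)
    show "(\<lambda>z\<in>M. inv_into M \<sigma> z) 1 = 1"
      using inv_into_f_f[OF inj is_subfieldD(1)[OF M]] field_emb_simps(1)[OF emb M]
      by (simp add: is_subfieldD(1)[OF M])
    fix a b assume "a \<in> M" "b \<in> M"
    then show "(\<lambda>z\<in>M. inv_into M \<sigma> z) (a + b) = (\<lambda>z\<in>M. inv_into M \<sigma> z) a + (\<lambda>z\<in>M. inv_into M \<sigma> z) b"
      "(\<lambda>z\<in>M. inv_into M \<sigma> z) (a * b) = (\<lambda>z\<in>M. inv_into M \<sigma> z) a * (\<lambda>z\<in>M. inv_into M \<sigma> z) b"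
      using Bij_inv_into_lemma[of M \<sigma> "(+)" a b] Bij_inv_into_lemma[of M \<sigma> "(*)" a b]
        \<open>\<sigma> \<in> Bij M\<close> field_emb_simps[OF emb M] by (auto simp: is_subfieldD[OF M])
  qed
  ultimately show "inv\<^bsub>BijGroup M\<^esub> \<sigma> \<in> {\<sigma>. field_emb M \<sigma> \<and> \<sigma> \<in> Bij M}"
    by (simp add: restrict_inv_into_Bij)
qed

lemma RingAutoGroup_type_ring:
  assumes M: "is_subfield M"
  shows "RingAutoGroup (type_ring\<lparr>carrier := M\<rparr>) = BijGroup M\<lparr>carrier := {\<sigma>. field_emb M \<sigma> \<and> \<sigma> \<in> Bij M}\<rparr>"
proof -
  have "ring_auto (type_ring\<lparr>carrier := M\<rparr>) = {\<sigma>. field_emb M \<sigma> \<and> \<sigma> \<in> Bij M}"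
    using ring_auto_iff[OF M] by blast
  then show ?thesis by (simp add: RingAutoGroup_def)
qed

lemma group_RingAutoGroup:
  assumes "is_subfield M"
  shows "group (RingAutoGroup (type_ring\<lparr>carrier := M\<rparr>))"
  unfolding RingAutoGroup_type_ring[OF assms]
  using subgroup.subgroup_is_group[OF subgroup_field_auts[OF assms] group_BijGroup] .

lemma RingAutoGroup_simps:
  assumes M: "is_subfield M"
  shows "\<one>\<^bsub>RingAutoGroup (type_ring\<lparr>carrier := M\<rparr>)\<^esub> = (\<lambda>z\<in>M. z)"
    "\<lbrakk>\<sigma> \<in> Bij M; \<tau> \<in> Bij M\<rbrakk> \<Longrightarrow> \<sigma> \<otimes>\<^bsub>RingAutoGroup (type_ring\<lparr>carrier := M\<rparr>)\<^esub> \<tau> = compose M \<sigma> \<tau>"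
    "\<lbrakk>\<sigma> \<in> Bij M; field_emb M \<sigma>\<rbrakk> \<Longrightarrow>
       inv\<^bsub>RingAutoGroup (type_ring\<lparr>carrier := M\<rparr>)\<^esub> \<sigma> = (\<lambda>z\<in>M. inv_into M \<sigma> z)"
  using group.m_inv_consistent[OF group_BijGroup subgroup_field_auts[OF M], of \<sigma>] inv_BijGroup[of \<sigma> M]
  by (auto simp: RingAutoGroup_type_ring[OF M] BijGroup_def)

lemma generate_Gal_subset:
  assumes M: "is_subfield M"
    and "\<sigma> \<in> generate (RingAutoGroup (type_ring\<lparr>carrier := M\<rparr>)) (Gal type_ring M L1 \<union> Gal type_ring M L2)"
  shows "field_emb M \<sigma>" "\<sigma> \<in> Bij M"
proof -
  have "Gal type_ring M L1 \<union> Gal type_ring M L2 \<subseteq> carrier (RingAutoGroup (type_ring\<lparr>carrier := M\<rparr>))"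
    by (auto simp: RingAutoGroup_type_ring[OF M] Gal_iff[OF M])
  then have "\<sigma> \<in> carrier (RingAutoGroup (type_ring\<lparr>carrier := M\<rparr>))"
    using group.generate_in_carrier[OF group_RingAutoGroup[OF M]] assms(2) by blast
  then show "field_emb M \<sigma>" "\<sigma> \<in> Bij M"
    by (auto simp: RingAutoGroup_type_ring[OF M])
qed

text \<open>An element outside \<open>L\<close> has another conjugate \<open>b\<close>. An embedding
  sending \<open>a\<close> to \<open>b\<close> and defined on all of \<open>M\<close> maps
  \<open>M\<close> onto itself, so its restriction is a Galois automorphism that moves
  \<open>a\<close>.\<close>

lemma Gal_fixed_field:
  fixes L :: "'k::field set"
  assumes closed: "alg_closed TYPE('k)" and char: "char_zero TYPE('k)"
    and L: "is_subfield L" and M: "is_subfield M" and "L \<subseteq> M"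
    and fin: "ring.finite_dimension type_ring L M"
    and normal: "\<And>a b. a \<in> M \<Longrightarrow> conjugate L a b \<Longrightarrow> b \<in> M"
    and al: "\<And>z. alg L z" and a: "a \<in> M" "\<And>\<sigma>. \<sigma> \<in> Gal type_ring M L \<Longrightarrow> \<sigma> a = a"
  shows "a \<in> L"
proof (rule ccontr)
  assume "a \<notin> L"
  then obtain b where b: "b \<noteq> a" "conjugate L a b"
    using other_conjugate_exists[OF closed char L al] by blast
  obtain A where A: "finite A" "\<And>L'. is_subfield L' \<Longrightarrow> L \<subseteq> L' \<Longrightarrow> A \<subseteq> L' \<Longrightarrow> M \<subseteq> L'"
    using finite_dimension_generators[OF L fin] by metis
  obtain L' \<tau> where \<tau>: "is_subfield L'" "L \<subseteq> L'" "A \<subseteq> L'" "field_emb L' \<tau>"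
    "\<And>z. z \<in> L \<Longrightarrow> \<tau> z = z" "\<tau> a = b"
    by (rule conjugate_extend[OF closed A(1) L al b(2)]) blast
  have M_sub: "M \<subseteq> L'" using A(2) \<tau> by blast
  have inj: "inj_on \<tau> M"
    using field_emb_inj_on[OF \<tau>(4,1)] M_sub inj_on_subset by blast
  have conj: "conjugate L z (\<tau> z)" if "z \<in> M" for z
    using field_emb_conjugate[OF L \<tau>(1,4,2,5)] that M_sub by blast
  then have into: "\<tau> ` M \<subseteq> M" using normal by blast
  have "M \<subseteq> \<tau> ` M"
  proof
    fix c assume c: "c \<in> M"
    obtain p where p: "p \<noteq> 0" "poly_over L p" "poly p c = 0"
      using al unfolding alg_def by blast
    define R where "R = {z \<in> M. poly p z = 0}"
    have "finite R" unfolding R_def using poly_roots_finite[OF p(1)] by simp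
    moreover have "\<tau> ` R \<subseteq> R"
      using into conj p(2) unfolding R_def conjugate_def by blast
    moreover have "inj_on \<tau> R" using inj unfolding R_def by (auto simp: inj_on_def)
    ultimately have "\<tau> ` R = R" by (rule endo_inj_surj)
    then show "c \<in> \<tau> ` M" using c p(3) unfolding R_def by blast
  qed
  then have "bij_betw \<tau> M M"
    using inj into by (auto simp: bij_betw_def)
  then have "restrict \<tau> M \<in> Bij M" by (simp add: Bij_def)
  moreover have "field_emb M (restrict \<tau> M)"
    using field_emb_mono[OF \<tau>(4) M_sub] is_subfieldD[OF M] by (simp add: field_emb_def)
  ultimately have "restrict \<tau> M \<in> Gal type_ring M L"
    using \<tau>(5) \<open>L \<subseteq> M\<close> by (auto simp: Gal_iff[OF M])
  then have "restrict \<tau> M a = a" by (rule a(2))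
  then show False using a(1) \<tau>(6) b(1) by simp
qed

lemma map_poly_emb_prod:
  assumes "field_emb L \<sigma>" "is_subfield L" "\<And>i. i \<in> I \<Longrightarrow> poly_over L (f i)"
  shows "map_poly \<sigma> (prod f I) = (\<Prod>i\<in>I. map_poly \<sigma> (f i))"
  using assms(3)
  by (induction I rule: infinite_finite_induct)
     (auto simp: map_poly_emb(3,5)[OF assms(1,2)] poly_over_prod[OF assms(2)])

text \<open>The polynomial is the product of \<open>X - a\<close> over the orbit \<open>A\<close> of
  \<open>x\<close> under the generated group. Each generator permutes the finite set
  \<open>A\<close> and hence fixes the coefficients.\<close>

lemma finite_group_invariant_poly:
  assumes M: "is_subfield M" and x: "x \<in> M"
    and fin: "finite (generate (RingAutoGroup (type_ring\<lparr>carrier := M\<rparr>)) (Gal type_ring M L1 \<union> Gal type_ring M L2))"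
  obtains p where "p \<noteq> 0" "poly p x = 0" "poly_over M p"
    "\<And>\<sigma> i. \<sigma> \<in> Gal type_ring M L1 \<union> Gal type_ring M L2 \<Longrightarrow> \<sigma> (Polynomial.coeff p i) = Polynomial.coeff p i"
proof -
  let ?R = "RingAutoGroup (type_ring\<lparr>carrier := M\<rparr>)"
  let ?H = "Gal type_ring M L1 \<union> Gal type_ring M L2"
  define A where "A = (\<lambda>g. g x) ` generate ?R ?H"
  define p where "p = (\<Prod>a\<in>A. [:- a, 1:])"
  have "finite A" using fin by (simp add: A_def)
  have AM: "A \<subseteq> M"
    using generate_Gal_subset(2)[OF M] x Bij_imp_funcset by (fastforce simp: A_def)
  have "x \<in> A"
    unfolding A_def using generate.one[of ?R ?H] x
    by (intro image_eqI[of _ _ "\<one>\<^bsub>?R\<^esub>"]) (simp_all add: RingAutoGroup_simps(1)[OF M])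
  have lin: "poly_over M [:- a, 1:]" if "a \<in> A" for a
    using that AM by (auto simp: poly_over_pCons_iff poly_over_intros[OF M] is_subfieldD[OF M])
  have "p \<noteq> 0" by (simp add: p_def \<open>finite A\<close>)
  moreover have "poly p x = 0"
    using \<open>x \<in> A\<close> \<open>finite A\<close> by (auto simp: p_def poly_prod)
  moreover have "poly_over M p"
    unfolding p_def by (rule poly_over_prod[OF M lin])
  moreover have "\<sigma> (Polynomial.coeff p i) = Polynomial.coeff p i" if \<sigma>: "\<sigma> \<in> ?H" for \<sigma> i
  proof -
    have emb: "field_emb M \<sigma>" and bij: "\<sigma> \<in> Bij M"
      using \<sigma> by (auto simp: Gal_iff[OF M])
    \<comment> \<open>The generated group is closed under multiplication on the left by
      \<open>\<sigma>\<close>.\<close>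
    have "\<sigma> ` A \<subseteq> A"
    proof
      fix z assume "z \<in> \<sigma> ` A"
      then obtain g where g: "g \<in> generate ?R ?H" "z = \<sigma> (g x)" by (auto simp: A_def)
      have "\<sigma> \<otimes>\<^bsub>?R\<^esub> g = compose M \<sigma> g"
        using RingAutoGroup_simps(2)[OF M bij] generate_Gal_subset(2)[OF M g(1)] .
      moreover have "\<sigma> \<otimes>\<^bsub>?R\<^esub> g \<in> generate ?R ?H"
        using generate.eng[OF generate.incl[OF \<sigma>] g(1)] .
      ultimately have "compose M \<sigma> g \<in> generate ?R ?H" by simp
      then show "z \<in> A" unfolding A_def
        by (rule rev_image_eqI) (simp add: g(2) compose_eq x)
    qed
    moreover have inj: "inj_on \<sigma> A"
      using field_emb_inj_on[OF emb M] AM inj_on_subset by blast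
    ultimately have "\<sigma> ` A = A"
      using \<open>finite A\<close> endo_inj_surj by blast
    have "map_poly \<sigma> p = (\<Prod>a\<in>A. map_poly \<sigma> [:- a, 1:])"
      unfolding p_def by (rule map_poly_emb_prod[OF emb M lin])
    also have "\<dots> = (\<Prod>a\<in>A. [:- \<sigma> a, 1:])"
    proof (rule prod.cong[OF refl])
      fix a assume "a \<in> A"
      then have "\<sigma> (- a) = - \<sigma> a"
        using AM field_emb_simps(6)[OF emb M] by blast
      then show "map_poly \<sigma> [:- a, 1:] = [:- \<sigma> a, 1:]"
        by (simp add: map_poly_emb(4)[OF emb M] field_emb_simps(1)[OF emb M])
    qed
    also have "\<dots> = (\<Prod>a\<in>\<sigma> ` A. [:- a, 1:])"
      by (simp add: prod.reindex[OF inj])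
    also have "\<dots> = p" by (simp add: p_def \<open>\<sigma> ` A = A\<close>)
    finally show ?thesis
      using coeff_map_emb[OF emb M, of p i] by simp
  qed
  ultimately show ?thesis using that by blast
qed

text \<open>Independence concerns bivariate polynomials with complex coefficients. It is converted
  here into a tower of two transcendence statements over subfields of \<open>'k\<close>.\<close>

lemma alg_independent2_imp_transcendental:
  assumes \<iota>: "\<iota> \<in> ring_hom (ring_of_type_algebra :: complex ring) type_ring" and indep: "alg_independent2 \<iota> x y"
  shows "is_subfield (range \<iota>)" "\<not> alg (range \<iota>) x" "\<not> alg (adjoin (range \<iota>) x) y"
    "\<iota> 0 = 0" "inj \<iota>"
proof -
  have h: "\<iota> (a + b) = \<iota> a + \<iota> b" "\<iota> (a * b) = \<iota> a * \<iota> b" "\<iota> 1 = 1" for a b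
    using ring_hom_add[OF \<iota>, of a b] ring_hom_mult[OF \<iota>, of a b] ring_hom_one[OF \<iota>]
    by (simp_all add: ring_of_type_algebra_def)
  show z: "\<iota> 0 = 0" using h(1)[of 0 0] by (metis add_cancel_left_left add_0)
  have m: "\<iota> (- a) = - \<iota> a" for a
    using h(1)[of a "- a"] z by (simp add: add_eq_0_iff)
  have i: "\<iota> a \<noteq> 0 \<and> \<iota> (inverse a) = inverse (\<iota> a)" if "a \<noteq> 0" for a
    using h(2)[of a "inverse a"] h(3) that
    by (metis inverse_unique mult_zero_left right_inverse zero_neq_one)
  show inj: "inj \<iota>"
  proof (rule injI)
    fix a b assume "\<iota> a = \<iota> b"
    then have "\<iota> (a - b) = 0" using h(1)[of a "- b"] m by simp
    then show "a = b" using i[of "a - b"] by auto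
  qed
  have i': "inverse (\<iota> a) = \<iota> (inverse a)" for a
    using i[of a] z by (cases "a = 0") auto
  show sf: "is_subfield (range \<iota>)"
  proof -
    have "1 \<in> range \<iota>" "- \<iota> a \<in> range \<iota>" "inverse (\<iota> a) \<in> range \<iota>"
      "\<iota> a + \<iota> b \<in> range \<iota>" "\<iota> a * \<iota> b \<in> range \<iota>" for a b
      using h m i' by (metis rangeI)+
    then show ?thesis unfolding is_subfield_def by blast
  qed
  \<comment> \<open>\<open>\<kappa>\<close> pulls coefficients in the range of
    \<open>\<iota>\<close> back to complex numbers, where independence applies.\<close>
  define \<kappa> where "\<kappa> = inv_into UNIV \<iota>"
  have \<kappa>: "\<iota> (\<kappa> a) = a" if "a \<in> range \<iota>" for a
    using that by (simp add: \<kappa>_def f_inv_into_f)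
  have \<kappa>0: "\<kappa> 0 = 0" using inj z by (metis \<kappa>_def inv_into_f_f UNIV_I)
  have lift: "map_poly \<iota> (map_poly \<kappa> p) = p" if "poly_over (range \<iota>) p" for p
    using that by (intro poly_eqI) (auto simp: coeff_map_poly z \<kappa>0 poly_over_def \<kappa>)
  have ind: "Q = 0" if "poly (map_poly (\<lambda>q. poly (map_poly \<iota> q) x) Q) y = 0" for Q
    using indep that unfolding alg_independent2_def by blast
  show "\<not> alg (range \<iota>) x"
  proof
    assume "alg (range \<iota>) x"
    then obtain p where p: "p \<noteq> 0" "poly_over (range \<iota>) p" "poly p x = 0"
      unfolding alg_def by blast
    \<comment> \<open>The outer variable stands for \<open>y\<close>, so a relation for
      \<open>x\<close> alone is a constant outer polynomial.\<close>
    have "[:map_poly \<kappa> p:] = 0"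
      by (rule ind) (simp add: map_poly_pCons lift[OF p(2)] p(3))
    then show False using lift[OF p(2)] p(1) by simp
  qed
  show "\<not> alg (adjoin (range \<iota>) x) y"
  proof
    assume "alg (adjoin (range \<iota>) x) y"
    then obtain p where p: "p \<noteq> 0" "poly_over (adjoin (range \<iota>) x) p" "poly p y = 0"
      unfolding alg_def by blast
    obtain Q e where Q: "\<And>i. poly_over (range \<iota>) (Polynomial.coeff Q i)" "e \<noteq> 0"
      "map_poly (\<lambda>q. poly q x) Q = Polynomial.smult e p"
      by (rule clear_denominators[OF sf p(2)]) blast
    have "map_poly (\<lambda>q. poly (map_poly \<iota> q) x) (map_poly (map_poly \<kappa>) Q) = map_poly (\<lambda>q. poly q x) Q"
      by (rule poly_eqI) (simp add: coeff_map_poly lift[OF Q(1)])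
    then have "map_poly (map_poly \<kappa>) Q = 0"
      by (intro ind) (simp add: Q(3) p(3))
    then have "map_poly \<kappa> (Polynomial.coeff Q i) = 0" for i
      by (metis coeff_0 coeff_map_poly map_poly_0)
    then have "Q = 0"
      using lift[OF Q(1)] by (intro poly_eqI) (metis coeff_0 map_poly_0)
    then show False using Q(2,3) p(1) by simp
  qed
qed

lemma gen_gen_Un: "gen (gen A \<union> B) = gen (A \<union> B)"
proof
  show "gen (gen A \<union> B) \<subseteq> gen (A \<union> B)"
    using gen_mono[of A "A \<union> B"] gen_incl[of "A \<union> B"] by (intro gen_least is_subfield_gen) auto
  show "gen (A \<union> B) \<subseteq> gen (gen A \<union> B)"
    using gen_incl[of A] by (intro gen_mono) auto
qed

lemma is_subfield_image:
  assumes "field_emb L \<sigma>" "is_subfield L"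
  shows "is_subfield (\<sigma> ` L)"
proof -
  note e = field_emb_simps[OF assms] and s = is_subfieldD[OF assms(2)]
  have "1 \<in> \<sigma> ` L" using e(1) s(1) by (metis imageI)
  moreover have "- \<sigma> a \<in> \<sigma> ` L" "inverse (\<sigma> a) \<in> \<sigma> ` L" if "a \<in> L" for a
    using e(6,7)[OF that] s(3,4)[OF that] by (metis imageI)+
  moreover have "\<sigma> a + \<sigma> b \<in> \<sigma> ` L" "\<sigma> a * \<sigma> b \<in> \<sigma> ` L" if "a \<in> L" "b \<in> L" for a b
    using e(3,5)[OF that] s(5,7)[OF that] by (metis imageI)+
  ultimately show ?thesis unfolding is_subfield_def by blast
qed

lemma alg_image_imp_alg:
  assumes \<sigma>: "field_emb L \<sigma>" and L: "is_subfield L" and L0: "is_subfield L0" "L0 \<subseteq> L" and c: "c \<in> L"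
    and "alg (\<sigma> ` L0) (\<sigma> c)"
  shows "alg L0 c"
proof -
  obtain p where p: "p \<noteq> 0" "poly_over (\<sigma> ` L0) p" "poly p (\<sigma> c) = 0"
    using assms(6) unfolding alg_def by blast
  define \<rho> where "\<rho> = inv_into L0 \<sigma>"
  have "\<rho> 0 = 0"
    using inv_into_f_f[OF field_emb_inj_on[OF field_emb_mono[OF \<sigma> L0(2)] L0(1)] is_subfieldD(2)[OF L0(1)]]
    by (simp add: \<rho>_def field_emb_simps(2)[OF \<sigma> L])
  define q where "q = map_poly \<rho> p"
  have q: "poly_over L0 q"
    using p(2) \<open>\<rho> 0 = 0\<close> by (auto simp: q_def poly_over_def coeff_map_poly \<rho>_def inv_into_into)
  have "map_poly \<sigma> q = p"
    using p(2) \<open>\<rho> 0 = 0\<close>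
    by (intro poly_eqI) (auto simp: coeff_map_emb[OF \<sigma> L] q_def coeff_map_poly \<rho>_def poly_over_def f_inv_into_f)
  then have "\<sigma> (poly q c) = 0" "q \<noteq> 0"
    using map_poly_emb(6)[OF \<sigma> L poly_over_mono[OF q L0(2)] c] p by auto
  then have "poly q c = 0"
    using field_emb_simps(8)[OF \<sigma> L] poly_in_subfield[OF L poly_over_mono[OF q L0(2)] c] by blast
  then show ?thesis using q \<open>q \<noteq> 0\<close> unfolding alg_def by blast
qed

section \<open>Orbits of step polynomials\<close>

text \<open>Exchanging the coordinates of steps and points exchanges \<open>sim_x\<close> and
  \<open>sim_y\<close>. With the next lemmas this reduces every statement about \<open>y\<close> to
  one about \<open>x\<close>.\<close>

lemma step_eval_swap:
  "step_eval \<iota> (prod.swap ` S) (w \<circ> prod.swap) v u = step_eval \<iota> S w u v"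
  unfolding step_eval_def
  by (subst sum.reindex) (auto intro!: sum.cong simp: mult.commute mult.left_commute)

lemma step_defined_swap: "step_defined (prod.swap ` S) v u \<longleftrightarrow> step_defined S u v"
  unfolding step_defined_def by fastforce

lemma same_step_value_swap:
  "same_step_value \<iota> (prod.swap ` S) (w \<circ> prod.swap) (prod.swap p) (prod.swap q) \<longleftrightarrow> same_step_value \<iota> S w p q"
  by (simp add: same_step_value_def step_eval_swap step_defined_swap)

lemma sim_swap:
  "sim_x \<iota> (prod.swap ` S) (w \<circ> prod.swap) (prod.swap p) (prod.swap q) \<longleftrightarrow> sim_y \<iota> S w p q"
  "sim_y \<iota> (prod.swap ` S) (w \<circ> prod.swap) (prod.swap p) (prod.swap q) \<longleftrightarrow> sim_x \<iota> S w p q"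
  by (simp_all add: sim_x_def sim_y_def same_step_value_swap)

lemma sim_sym:
  "sim_x \<iota> S w p q \<Longrightarrow> sim_x \<iota> S w q p" "sim_y \<iota> S w p q \<Longrightarrow> sim_y \<iota> S w q p"
  by (auto simp: sim_x_def sim_y_def same_step_value_def)

lemma step_orbit_base: "(x, y) \<in> step_orbit \<iota> S w x y"
  by (simp add: step_orbit_def)

lemma step_orbit_step:
  "p \<in> step_orbit \<iota> S w x y \<Longrightarrow> sim_x \<iota> S w p q \<Longrightarrow> q \<in> step_orbit \<iota> S w x y"
  "p \<in> step_orbit \<iota> S w x y \<Longrightarrow> sim_y \<iota> S w p q \<Longrightarrow> q \<in> step_orbit \<iota> S w x y"
  unfolding step_orbit_def
  by (auto intro: equivclp_into_equivclp)

text \<open>Both relations are symmetric, so backward steps of the equivalence closure can be read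
  as forward steps.\<close>

lemma step_orbit_induct [consumes 1, case_names base step_x step_y]:
  assumes "q \<in> step_orbit \<iota> S w x y" "P (x, y)"
    and "\<And>p q. p \<in> step_orbit \<iota> S w x y \<Longrightarrow> P p \<Longrightarrow> sim_x \<iota> S w p q \<Longrightarrow> P q"
    and "\<And>p q. p \<in> step_orbit \<iota> S w x y \<Longrightarrow> P p \<Longrightarrow> sim_y \<iota> S w p q \<Longrightarrow> P q"
  shows "P q"
proof -
  have "equivclp (sup (sim_x \<iota> S w) (sim_y \<iota> S w)) (x, y) q"
    using assms(1) by (simp add: step_orbit_def)
  then show ?thesis
  proof (induction rule: equivclp_induct)
    case (step p q)
    then show ?case
      using assms(3,4)[of p q] sim_sym[of \<iota> S w q p] by (auto simp: step_orbit_def)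
  qed (rule assms(2))
qed

lemma step_orbit_swap:
  "step_orbit \<iota> (prod.swap ` S) (w \<circ> prod.swap) y x = prod.swap ` step_orbit \<iota> S w x y"
proof -
  have *: "prod.swap q \<in> step_orbit \<iota> (prod.swap ` S) (w \<circ> prod.swap) y x"
    if "q \<in> step_orbit \<iota> S w x y" for q S w x y
    using that
  proof (induction rule: step_orbit_induct)
    case base
    then show ?case by (simp add: step_orbit_base)
  next
    case (step_x p q)
    then show ?case using step_orbit_step(2) sim_swap(2) by metis
  next
    case (step_y p q)
    then show ?case using step_orbit_step(1) sim_swap(1) by metis
  qed
  have inv: "prod.swap ` prod.swap ` S = S" "w \<circ> prod.swap \<circ> prod.swap = w"
    by (auto simp: image_image fun_eq_iff)
  show ?thesis
    using *[of _ S w x y] *[of _ "prod.swap ` S" "w \<circ> prod.swap" y x] unfolding inv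
    by (auto simp: image_iff) (metis swap_simp swap_swap)+
qed

section \<open>Transcendence and algebraicity around the step polynomial\<close>

locale step_setting =
  fixes S :: "(int \<times> int) set" and w :: "int \<times> int \<Rightarrow> complex" and \<iota> :: "complex \<Rightarrow> 'k::field" and x y :: 'k
  assumes finite_steps: "finite S"
    and weights_nonzero: "s \<in> S \<Longrightarrow> w s \<noteq> 0"
    and involves_X: "\<exists>s\<in>S. fst s \<noteq> 0"
    and involves_Y: "\<exists>s\<in>S. snd s \<noteq> 0"
    and const_subfield: "is_subfield (range \<iota>)"
    and \<iota>_eq_0_iff: "\<iota> c = 0 \<longleftrightarrow> c = 0"
    and x_transcendental: "\<not> alg (range \<iota>) x"
    and y_transcendental: "\<not> alg (adjoin (range \<iota>) x) y"
    and closed: "alg_closed TYPE('k)"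
    and char: "char_zero TYPE('k)"
    and algebraic_over_xy: "alg (gen (range \<iota> \<union> {x, y})) z"
begin

abbreviation "t \<equiv> step_eval \<iota> S w x y"
abbreviation "base \<equiv> gen (range \<iota> \<union> {t})"
abbreviation "base_x \<equiv> gen (range \<iota> \<union> {t, x})"
abbreviation "base_y \<equiv> gen (range \<iota> \<union> {t, y})"
abbreviation "orbit \<equiv> step_orbit \<iota> S w x y"
abbreviation "orbit_field \<equiv> gen (range \<iota> \<union> (fst ` orbit \<union> snd ` orbit))"

lemma range_subset_adjoin: "range \<iota> \<subseteq> adjoin (range \<iota>) a" "a \<in> adjoin (range \<iota>) a"
  using gen_incl[of "range \<iota> \<union> {a}"] by (auto simp: adjoin_eq_gen[OF const_subfield])

lemma is_subfield_adjoin: "is_subfield (adjoin (range \<iota>) a)"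
  using is_subfield_gen[of "range \<iota> \<union> {a}"] by (simp add: adjoin_eq_gen[OF const_subfield])

text \<open>The locale assumptions treat \<open>x\<close> and \<open>y\<close> asymmetrically; the
  exchange property makes \<open>x\<close> transcendental over the constants extended by
  \<open>y\<close>. Every later result can thus be reused with the variables swapped.\<close>

lemma swapped: "step_setting (prod.swap ` S) (w \<circ> prod.swap) \<iota> y x"
proof
  show "\<not> alg (range \<iota>) y"
    using y_transcendental alg_mono range_subset_adjoin(1) by blast
  show "\<not> alg (adjoin (range \<iota>) y) x"
    using y_transcendental alg_exchange[OF const_subfield _ x_transcendental] by blast
  show "alg (gen (range \<iota> \<union> {y, x})) z" for z
    using algebraic_over_xy by (simp add: insert_commute)
qed (use finite_steps involves_X involves_Y const_subfield \<iota>_eq_0_iff closed char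
      in \<open>auto dest: weights_nonzero\<close>)

lemma step_eval_in_subfield:
  assumes "is_subfield E" "range \<iota> \<subseteq> E" "u \<in> E" "v \<in> E"
  shows "step_eval \<iota> S w u v \<in> E"
  unfolding step_eval_def using assms
  by (auto intro!: is_subfield_sum is_subfieldD(7) is_subfield_powi)

lemma field_emb_step_eval:
  assumes "field_emb L \<sigma>" "is_subfield L" "range \<iota> \<subseteq> L" "\<And>c. \<sigma> (\<iota> c) = \<iota> c" "u \<in> L" "v \<in> L"
  shows "\<sigma> (step_eval \<iota> S w u v) = step_eval \<iota> S w (\<sigma> u) (\<sigma> v)"
proof -
  have mem: "\<iota> c \<in> L" "u powi i \<in> L" "v powi i \<in> L" for c i
    using assms is_subfield_powi by auto
  then have "\<sigma> (\<iota> c * u powi i * v powi j) = \<iota> c * \<sigma> u powi i * \<sigma> v powi j" for c i j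
    using assms is_subfieldD(7)[OF assms(2)]
    by (simp add: field_emb_simps(5)[OF assms(1,2)] field_emb_powi[OF assms(1,2)])
  then show ?thesis
    unfolding step_eval_def using mem
    by (subst field_emb_sum[OF assms(1,2)])
       (auto intro!: sum.cong is_subfieldD(7)[OF assms(2)])
qed

text \<open>Clearing negative powers of \<open>Y\<close> in \<open>S(u,Y) - S(u,v)\<close> gives a
  polynomial over \<open>E\<close> with root \<open>v\<close>. It is nonzero because some step
  involves \<open>Y\<close> and \<open>u\<close> satisfies no algebraic relation over the
  constants.\<close>

lemma alg_second_coordinate:
  assumes E: "is_subfield E" "range \<iota> \<subseteq> E" and u: "u \<in> E" "\<not> alg (range \<iota>) u"
    and v: "v \<noteq> 0" and s: "step_eval \<iota> S w u v \<in> E"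
  shows "alg E v"
proof -
  have u0: "u \<noteq> 0"
    using u(2) alg_self[OF const_subfield is_subfieldD(2)[OF const_subfield]] by blast
  obtain i0 j0 where ij: "(i0, j0) \<in> S" "j0 \<noteq> 0"
    using involves_Y by auto
  \<comment> \<open>\<open>N\<close> bounds every exponent in absolute value, so adding it turns all
    exponents into natural numbers.\<close>
  define N where "N = (\<Sum>(i, j)\<in>S. \<bar>i\<bar> + \<bar>j\<bar>)"
  have N: "\<bar>i\<bar> \<le> N" "\<bar>j\<bar> \<le> N" if "(i, j) \<in> S" for i j
  proof -
    have "\<bar>i\<bar> + \<bar>j\<bar> \<le> N"
      unfolding N_def using member_le_sum[OF that, of "\<lambda>(i, j). \<bar>i\<bar> + \<bar>j\<bar>"] finite_steps by auto
    then show "\<bar>i\<bar> \<le> N" "\<bar>j\<bar> \<le> N" by auto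
  qed
  have N0: "N \<ge> 0" using N(1)[OF ij(1)] by linarith
  have shift: "a powi j * a ^ nat N = a ^ nat (j + N)" if "\<bar>j\<bar> \<le> N" "a \<noteq> 0" for a :: 'k and j
  proof -
    have "a ^ nat (j + N) = a powi (j + N)" "a ^ nat N = a powi N"
      using that N0 by (simp_all add: power_int_def)
    then show ?thesis using that by (simp add: power_int_add)
  qed
  define P where "P = (\<Sum>(i, j)\<in>S. Polynomial.monom (\<iota> (w (i, j)) * u powi i) (nat (j + N)))
      - Polynomial.monom (step_eval \<iota> S w u v) (nat N)"
  have "poly_over E P"
    unfolding P_def using E u(1) s
    by (intro poly_over_intros[OF E(1)] poly_over_sum[OF E(1)])
       (auto intro!: poly_over_intros[OF E(1)] is_subfieldD(7) is_subfield_powi)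
  moreover have "poly P v = 0"
  proof -
    have "(\<Sum>(i, j)\<in>S. \<iota> (w (i, j)) * u powi i * v ^ nat (j + N)) = step_eval \<iota> S w u v * v ^ nat N"
      unfolding step_eval_def sum_distrib_right
      using N shift[OF _ v] by (intro sum.cong) (auto simp: mult.assoc)
    then show ?thesis
      by (simp add: P_def poly_sum poly_monom case_prod_unfold)
  qed
  moreover have "P \<noteq> 0"
  proof
    assume "P = 0"
    \<comment> \<open>Since \<open>j0\<close> is nonzero, the subtracted term with exponent
      \<open>N\<close> does not contribute at \<open>j0 + N\<close>. The coefficient there is a
      Laurent polynomial in \<open>u\<close>; multiplied by the \<open>N\<close>-th power of
      \<open>u\<close> it becomes \<open>Q(u)\<close>, where \<open>Q\<close> has a nonzero weight
      among its coefficients.\<close>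
    define I where "I = {i. (i, j0) \<in> S}"
    have "finite I"
      unfolding I_def using finite_imageI[OF finite_steps, of fst] by (rule rev_finite_subset) force
    have "nat (j + N) = nat (j0 + N) \<longleftrightarrow> j = j0" if "(i, j) \<in> S" for i j
      using N(2)[OF that] N(2)[OF ij(1)] by auto
    then have "Polynomial.coeff P (nat (j0 + N)) =
        (\<Sum>(i, j)\<in>S. if j = j0 then \<iota> (w (i, j)) * u powi i else 0)"
      using N(2)[OF ij(1)] ij(2) N0
      by (auto simp: P_def Polynomial.coeff_sum case_prod_unfold intro!: sum.cong)
    also have "\<dots> = (\<Sum>(i, j)\<in>(\<lambda>i. (i, j0)) ` I. \<iota> (w (i, j)) * u powi i)"
      using finite_steps by (intro sum.mono_neutral_cong_right) (auto simp: I_def)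
    also have "\<dots> = (\<Sum>i\<in>I. \<iota> (w (i, j0)) * u powi i)"
      by (subst sum.reindex) (auto simp: inj_on_def)
    finally have z: "(\<Sum>i\<in>I. \<iota> (w (i, j0)) * u powi i) = 0"
      by (simp add: \<open>P = 0\<close>)
    define Q where "Q = (\<Sum>i\<in>I. Polynomial.monom (\<iota> (w (i, j0))) (nat (i + N)))"
    have "poly Q u = (\<Sum>i\<in>I. \<iota> (w (i, j0)) * u powi i) * u ^ nat N"
      unfolding Q_def poly_sum poly_monom sum_distrib_right
      using N shift[OF _ u0] by (intro sum.cong) (auto simp: mult.assoc I_def)
    then have "poly Q u = 0" by (simp add: z)
    moreover have "poly_over (range \<iota>) Q"
      unfolding Q_def
      by (intro poly_over_sum[OF const_subfield] poly_over_intros[OF const_subfield]) auto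
    moreover have "Polynomial.coeff Q (nat (i0 + N)) = \<iota> (w (i0, j0))"
    proof -
      have "nat (i + N) = nat (i0 + N) \<longleftrightarrow> i = i0" if "i \<in> I" for i
        using N(1)[of i j0] that N(1)[OF ij(1)] by (auto simp: I_def)
      then have "Polynomial.coeff Q (nat (i0 + N)) = (\<Sum>i\<in>I. if i = i0 then \<iota> (w (i, j0)) else 0)"
        by (auto simp: Q_def Polynomial.coeff_sum intro!: sum.cong)
      then show ?thesis using \<open>finite I\<close> ij(1) by (simp add: I_def)
    qed
    ultimately show False
      using u(2) weights_nonzero[OF ij(1)] \<iota>_eq_0_iff unfolding alg_def by (metis coeff_0)
  qed
  ultimately show ?thesis unfolding alg_def by blast
qed

lemma coordinates_nonzero: "x \<noteq> 0" "y \<noteq> 0"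
  using x_transcendental y_transcendental alg_self[OF const_subfield is_subfieldD(2)[OF const_subfield]]
    alg_self[OF is_subfield_adjoin is_subfieldD(2)[OF is_subfield_adjoin]] by blast+

text \<open>The field of all elements algebraic over \<open>k(x)\<close> contains \<open>x\<close>
  and, by the equation \<open>S(x,Y) = t\<close>, also \<open>y\<close>; everything is algebraic
  over these two.\<close>

lemma algebraic_over_base_x: "alg base_x z"
proof (rule alg_trans[OF is_subfield_gen alg_mono[OF algebraic_over_xy]])
  have sub: "range \<iota> \<subseteq> base_x" "t \<in> base_x" "x \<in> base_x"
    using gen_incl[of "range \<iota> \<union> {t, x}"] by auto
  then have "alg base_x y"
    using alg_second_coordinate[OF is_subfield_gen _ _ x_transcendental coordinates_nonzero(2)] by blast
  then show "gen (range \<iota> \<union> {x, y}) \<subseteq> {a. alg base_x a}"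
    using sub alg_self[OF is_subfield_gen]
    by (intro gen_least is_subfield_algebraics is_subfield_gen) auto
qed

text \<open>Otherwise exchange makes \<open>t\<close> algebraic over the constants extended by
  \<open>x\<close>, and then the equation \<open>S(x,Y) = t\<close> makes \<open>y\<close> algebraic
  over that field too.\<close>

lemma x_not_alg_over_base: "\<not> alg base x"
proof
  assume "alg base x"
  then have "alg (adjoin (range \<iota>) t) x" by (simp add: adjoin_eq_gen[OF const_subfield])
  then have t: "alg (adjoin (range \<iota>) x) t"
    by (rule alg_exchange[OF const_subfield _ x_transcendental])
  let ?A = "{a. alg (adjoin (range \<iota>) x) a}"
  have "adjoin (range \<iota>) x \<subseteq> ?A" using alg_self[OF is_subfield_adjoin] by blast
  then have "alg ?A y"
    using alg_second_coordinate[OF is_subfield_algebraics[OF is_subfield_adjoin] _ _ x_transcendental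
        coordinates_nonzero(2)] range_subset_adjoin t by blast
  then show False
    using alg_trans[OF is_subfield_adjoin] y_transcendental by blast
qed

section \<open>From a nontrivial invariant to a finite orbit\<close>

lemma base_x_memI: "range \<iota> \<subseteq> base_x" "t \<in> base_x" "x \<in> base_x" "base \<subseteq> base_x"
  using gen_incl[of "range \<iota> \<union> {t, x}"] gen_mono[of "range \<iota> \<union> {t}" "range \<iota> \<union> {t, x}"] by auto

text \<open>Over the image of the constants extended by \<open>x\<close>, the new value
  \<open>v'\<close> is as transcendental as \<open>\<phi> y\<close>, so \<open>y\<close> may be sent
  to it freely. Both embeddings agree on the constants, \<open>x\<close> and \<open>t\<close>, hence
  on \<open>k(x)\<close>.\<close>

lemma orbit_embedding_step_x:
  defines "F \<equiv> gen (range \<iota> \<union> {x, y})"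
  assumes \<phi>: "field_emb F \<phi>" "\<And>c. \<phi> (\<iota> c) = \<iota> c" "\<phi> t = t" and v': "step_eval \<iota> S w (\<phi> x) v' = t"
  obtains \<phi>' where "field_emb F \<phi>'" "\<And>c. \<phi>' (\<iota> c) = \<iota> c" "\<phi>' x = \<phi> x" "\<phi>' y = v'"
    "\<And>z. z \<in> base_x \<Longrightarrow> \<phi>' z = \<phi> z"
proof -
  have F: "is_subfield F" unfolding F_def by (rule is_subfield_gen)
  have inF: "range \<iota> \<subseteq> F" "x \<in> F" "y \<in> F"
    using gen_incl[of "range \<iota> \<union> {x, y}"] unfolding F_def by auto
  define C where "C = adjoin (range \<iota>) x"
  have C: "is_subfield C" "range \<iota> \<subseteq> C" "x \<in> C"
    unfolding C_def using is_subfield_adjoin range_subset_adjoin by blast+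
  have CF: "C \<subseteq> F"
    unfolding C_def adjoin_eq_gen[OF const_subfield] F_def by (rule gen_mono) auto
  have embC: "field_emb C \<phi>" by (rule field_emb_mono[OF \<phi>(1) CF])
  have "adjoin C y = gen ((range \<iota> \<union> {x}) \<union> {y})"
    unfolding adjoin_eq_gen[OF C(1)] unfolding C_def adjoin_eq_gen[OF const_subfield] gen_gen_Un ..
  then have Fy: "F = adjoin C y"
    by (simp add: F_def insert_commute)
  have imC: "\<phi> ` range \<iota> = range \<iota>" using \<phi>(2) by (auto simp: image_iff)
  have u: "\<not> alg (range \<iota>) (\<phi> x)"
    using alg_image_imp_alg[OF \<phi>(1) F const_subfield inF(1,2)] x_transcendental imC by auto
  have tr: "\<not> alg (\<phi> ` C) (\<phi> y)"
    using alg_image_imp_alg[OF \<phi>(1) F C(1) CF inF(3)] y_transcendental unfolding C_def by blast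
  have v0: "\<phi> y \<noteq> 0"
    using field_emb_simps(8)[OF \<phi>(1) F inF(3)] coordinates_nonzero by blast
  \<comment> \<open>If \<open>v'\<close> were algebraic over the image field, so would be
    \<open>t\<close>, and then \<open>\<phi> y\<close> as a solution of the same equation; but
    \<open>\<phi>\<close> preserves the transcendence of \<open>y\<close>.\<close>
  have v't: "\<not> alg (\<phi> ` C) v'"
  proof
    assume "alg (\<phi> ` C) v'"
    note sf = is_subfield_image[OF embC C(1)]
    let ?A = "{a. alg (\<phi> ` C) a}"
    have A: "is_subfield ?A" "\<phi> ` C \<subseteq> ?A"
      using is_subfield_algebraics[OF sf] alg_self[OF sf] by blast+
    have sub: "range \<iota> \<subseteq> ?A" "\<phi> x \<in> ?A"
      using A(2) C imC by blast+
    have "t \<in> ?A"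
      using step_eval_in_subfield[OF A(1) sub, of v'] \<open>alg (\<phi> ` C) v'\<close> v' by simp
    moreover have "step_eval \<iota> S w (\<phi> x) (\<phi> y) = t"
      using field_emb_step_eval[OF \<phi>(1) F inF(1) \<phi>(2) inF(2,3)] \<phi>(3) by simp
    ultimately have "alg ?A (\<phi> y)"
      using alg_second_coordinate[OF A(1) sub u v0] by simp
    then show False using alg_trans[OF sf] tr by blast
  qed
  \<comment> \<open>By transcendence on both sides, neither value vanishes for a nonzero
    \<open>p\<close>.\<close>
  have iff: "poly p y = 0 \<longleftrightarrow> poly (map_poly \<phi> p) v' = 0" if p: "poly_over C p" for p
  proof (cases "p = 0")
    case False
    have "poly_over (\<phi> ` C) (map_poly \<phi> p)"
      using p by (auto simp: poly_over_def coeff_map_emb[OF embC C(1)])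
    moreover have "map_poly \<phi> p \<noteq> 0"
      using map_poly_emb(8)[OF embC C(1) p] False by simp
    ultimately have "poly (map_poly \<phi> p) v' \<noteq> 0"
      using v't unfolding alg_def by blast
    moreover have "poly p y \<noteq> 0"
      using y_transcendental False p unfolding alg_def C_def by blast
    ultimately show ?thesis by simp
  qed simp
  have "\<exists>\<phi>'. field_emb (adjoin C y) \<phi>' \<and> (\<forall>a\<in>C. \<phi>' a = \<phi> a) \<and> \<phi>' y = v'"
    by (rule field_emb_extend[OF C(1) embC iff]) blast+
  then obtain \<phi>' where \<phi>': "field_emb (adjoin C y) \<phi>'" "\<And>a. a \<in> C \<Longrightarrow> \<phi>' a = \<phi> a" "\<phi>' y = v'"
    by blast
  have emb': "field_emb F \<phi>'" using \<phi>'(1) by (simp add: Fy)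
  have fix': "\<phi>' (\<iota> c) = \<iota> c" for c
    using \<phi>'(2)[of "\<iota> c"] C(2) \<phi>(2) by auto
  have "\<phi>' t = t"
    using field_emb_step_eval[OF emb' F inF(1) fix' inF(2,3)] \<phi>'(2)[OF C(3)] \<phi>'(3) v' by simp
  have bF: "base_x \<subseteq> F"
    using inF step_eval_in_subfield[OF F inF] by (intro gen_least F) auto
  have "\<phi>' z = \<phi> z" if z: "z \<in> base_x" for z
    by (rule field_emb_eq_on_gen[OF field_emb_mono[OF emb' bF] field_emb_mono[OF \<phi>(1) bF] _ z])
       (use fix' \<phi>(2,3) \<phi>'(2)[OF C(3)] \<open>\<phi>' t = t\<close> in auto)
  then show ?thesis
    using that[OF emb' fix' \<phi>'(2)[OF C(3)] \<phi>'(3)] by blast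
qed

text \<open>Write \<open>f\<close> as \<open>p(x) / q(x)\<close> over \<open>k\<close>. An embedding
  fixing \<open>k\<close> and \<open>f\<close> sends \<open>x\<close> to a root of
  \<open>p - f q\<close>, which is nonzero because otherwise \<open>f\<close> would be a quotient of
  coefficients in \<open>k\<close>.\<close>

lemma invariant_imp_finite_coordinates:
  assumes f: "f \<in> base_x" "f \<notin> base"
  shows "finite {u. \<exists>\<phi>. field_emb (gen (range \<iota> \<union> {x, y})) \<phi> \<and> (\<forall>c. \<phi> (\<iota> c) = \<iota> c) \<and>
           \<phi> t = t \<and> \<phi> f = f \<and> \<phi> x = u}" (is "finite ?U")
proof -
  let ?F = "gen (range \<iota> \<union> {x, y})"
  have k: "is_subfield base" by (rule is_subfield_gen)
  have "f \<in> adjoin base x"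
    using f(1) unfolding adjoin_eq_gen[OF k] gen_gen_Un by (simp add: insert_commute)
  then obtain p q where pq: "poly_over base p" "poly_over base q" "f = poly p x / poly q x"
    unfolding adjoin_def by blast
  have q0: "poly q x \<noteq> 0"
    using f(2) pq(3) is_subfieldD(2)[OF k] by auto
  define r where "r = p - Polynomial.smult f q"
  have "r \<noteq> 0"
  proof
    assume "r = 0"
    then have eq: "Polynomial.coeff p i = f * Polynomial.coeff q i" for i
      by (auto simp: r_def dest!: arg_cong[of _ _ "\<lambda>p. Polynomial.coeff p i"])
    obtain i where "Polynomial.coeff q i \<noteq> 0"
      using q0 by (metis leading_coeff_0_iff poly_0)
    then have "f = Polynomial.coeff p i / Polynomial.coeff q i" using eq by simp
    then have "f \<in> base"
      using is_subfieldD(8)[OF k] pq(1,2) unfolding poly_over_def by metis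
    then show False using f(2) by blast
  qed
  have inF: "range \<iota> \<subseteq> ?F" "x \<in> ?F" "y \<in> ?F"
    using gen_incl[of "range \<iota> \<union> {x, y}"] by auto
  have kF: "base \<subseteq> ?F" "base_x \<subseteq> ?F"
    using inF step_eval_in_subfield[OF is_subfield_gen inF] by (auto intro!: gen_least[OF is_subfield_gen] simp del: subset_iff)
  have "?U \<subseteq> {u. poly r u = 0}"
  proof
    fix u assume "u \<in> ?U"
    then obtain \<phi> where \<phi>: "field_emb ?F \<phi>" "\<And>c. \<phi> (\<iota> c) = \<iota> c" "\<phi> t = t" "\<phi> f = f" "\<phi> x = u"
      by blast
    have fixk: "\<phi> z = z" if "z \<in> base" for z
      using field_emb_eq_on_gen[OF field_emb_mono[OF \<phi>(1) kF(1)] field_emb_id _ that] \<phi>(2,3) by auto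
    have ev: "\<phi> (poly p x) = poly p u" if "poly_over base p" for p
      using map_poly_emb(6)[OF \<phi>(1) is_subfield_gen poly_over_mono[OF that kF(1)] inF(2)]
        map_poly_fixed[OF fixk k that] \<phi>(5) by simp
    have "poly p x = f * poly q x" using pq(3) q0 by simp
    then have "\<phi> (poly p x) = \<phi> f * \<phi> (poly q x)"
      using field_emb_simps(5)[OF \<phi>(1) is_subfield_gen] kF(2) f(1)
        poly_in_subfield[OF is_subfield_gen poly_over_mono[OF pq(2) kF(1)] inF(2)] by auto
    then show "u \<in> {u. poly r u = 0}"
      using ev[OF pq(1)] ev[OF pq(2)] \<phi>(4) by (simp add: r_def)
  qed
  then show ?thesis
    using poly_roots_finite[OF \<open>r \<noteq> 0\<close>] finite_subset by blast
qed

text \<open>What is propagated along the orbit is an embedding rather than a point. Membership of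
  \<open>f\<close> in \<open>k(x)\<close> keeps it fixed under \<open>sim_x\<close> steps,
  membership in \<open>k(y)\<close> under \<open>sim_y\<close> steps.\<close>

lemma invariant_imp_finite_orbit:
  assumes f: "f \<in> base_x" "f \<in> base_y" "f \<notin> base"
  shows "finite orbit"
proof -
  interpret sw: step_setting "prod.swap ` S" "w \<circ> prod.swap" \<iota> y x by (rule swapped)
  let ?F = "gen (range \<iota> \<union> {x, y})"
  define good where "good \<phi> \<longleftrightarrow> field_emb ?F \<phi> \<and> (\<forall>c. \<phi> (\<iota> c) = \<iota> c) \<and> \<phi> t = t \<and> \<phi> f = f" for \<phi>
  have inF: "range \<iota> \<subseteq> ?F" "x \<in> ?F" "y \<in> ?F"
    using gen_incl[of "range \<iota> \<union> {x, y}"] by auto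
  have val: "step_eval \<iota> S w (\<phi> x) (\<phi> y) = t" if "good \<phi>" for \<phi>
    using field_emb_step_eval[OF _ is_subfield_gen inF(1) _ inF(2,3), of \<phi>] that unfolding good_def by simp
  have "\<exists>\<phi>. good \<phi> \<and> q = (\<phi> x, \<phi> y)" if "q \<in> orbit" for q
    using that
  proof (induction rule: step_orbit_induct)
    case base
    have "good (\<lambda>z. z)" by (simp add: good_def field_emb_id)
    then show ?case by blast
  next
    case (step_x p q)
    then obtain \<phi> where \<phi>: "good \<phi>" "p = (\<phi> x, \<phi> y)" by blast
    obtain v' where q: "q = (\<phi> x, v')" "step_eval \<iota> S w (\<phi> x) v' = t"
      using step_x(2) \<phi> val[OF \<phi>(1)] by (cases q) (auto simp: sim_x_def same_step_value_def)
    have g: "field_emb ?F \<phi>" "\<And>c. \<phi> (\<iota> c) = \<iota> c" "\<phi> t = t" "\<phi> f = f"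
      using \<phi>(1) by (simp_all add: good_def)
    obtain \<phi>' where \<phi>': "field_emb ?F \<phi>'" "\<And>c. \<phi>' (\<iota> c) = \<iota> c" "\<phi>' x = \<phi> x" "\<phi>' y = v'"
      "\<And>z. z \<in> base_x \<Longrightarrow> \<phi>' z = \<phi> z"
      by (rule orbit_embedding_step_x[OF g(1,2,3) q(2)]) blast
    then have "good \<phi>'" using g(3,4) f(1) base_x_memI(2) by (simp add: good_def)
    then show ?case using \<phi>'(3,4) q(1) by auto
  next
    case (step_y p q)
    then obtain \<phi> where \<phi>: "good \<phi>" "p = (\<phi> x, \<phi> y)" by blast
    obtain u' where q: "q = (u', \<phi> y)" "step_eval \<iota> S w u' (\<phi> y) = t"
      using step_y(2) \<phi> val[OF \<phi>(1)] by (cases q) (auto simp: sim_y_def same_step_value_def)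
    have g: "field_emb (gen (range \<iota> \<union> {y, x})) \<phi>" "\<And>c. \<phi> (\<iota> c) = \<iota> c" "\<phi> sw.t = sw.t" "\<phi> f = f"
      using \<phi>(1) by (simp_all add: good_def insert_commute step_eval_swap)
    obtain \<phi>' where \<phi>': "field_emb (gen (range \<iota> \<union> {y, x})) \<phi>'" "\<And>c. \<phi>' (\<iota> c) = \<iota> c"
      "\<phi>' y = \<phi> y" "\<phi>' x = u'" "\<And>z. z \<in> sw.base_x \<Longrightarrow> \<phi>' z = \<phi> z"
      by (rule sw.orbit_embedding_step_x[OF g(1,2,3), of u']) (simp add: step_eval_swap q(2), blast)
    have "f \<in> sw.base_x" using f(2) by (simp add: step_eval_swap)
    then have "good \<phi>'" using g(3,4) \<phi>' sw.base_x_memI(2) by (simp add: good_def insert_commute step_eval_swap)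
    then show ?case using \<phi>'(3,4) q(1) by auto
  qed
  then have "orbit \<subseteq> {u. \<exists>\<phi>. good \<phi> \<and> \<phi> x = u} \<times> {v. \<exists>\<phi>. good \<phi> \<and> \<phi> y = v}"
    by fastforce
  moreover have "finite {u. \<exists>\<phi>. good \<phi> \<and> \<phi> x = u}"
    using invariant_imp_finite_coordinates[OF f(1,3)] by (simp add: good_def conj_assoc)
  moreover have "finite {v. \<exists>\<phi>. good \<phi> \<and> \<phi> y = v}"
    using sw.invariant_imp_finite_coordinates[of f] f(2,3)
    by (simp add: good_def conj_assoc step_eval_swap insert_commute)
  ultimately show ?thesis
    by (meson finite_SigmaI finite_subset)
qed

text \<open>The invariant polynomial of the finite group has \<open>x\<close> as a root. If both
  fields met only in \<open>k\<close>, its coefficients would lie in \<open>k\<close>, against the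
  transcendence of \<open>x\<close> over \<open>k\<close>.\<close>

lemma finite_galois_imp_invariant:
  assumes M: "finite_galois_ext type_ring base_x M" "finite_galois_ext type_ring base_y M"
    and fin: "finite (generate (RingAutoGroup (type_ring\<lparr>carrier := M\<rparr>))
               (Gal type_ring M base_x \<union> Gal type_ring M base_y))"
  shows "\<exists>f. f \<in> base_x \<and> f \<in> base_y \<and> f \<notin> base"
proof (rule ccontr)
  interpret sw: step_setting "prod.swap ` S" "w \<circ> prod.swap" \<iota> y x by (rule swapped)
  assume "\<not> ?thesis"
  then have sub: "base_x \<inter> base_y \<subseteq> base" by blast
  have sM: "is_subfield M" and dim: "base_x \<subseteq> M" "base_y \<subseteq> M"
    "ring.finite_dimension type_ring base_x M" "ring.finite_dimension type_ring base_y M"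
    and nor: "normal_ext type_ring base_x M" "normal_ext type_ring base_y M"
    using M by (simp_all add: finite_galois_ext_def subfield_type_ring_iff)
  have conj_x: "b \<in> M" if "a \<in> M" "conjugate base_x a b" for a b
    using nor(1) that unfolding normal_ext_iff[OF closed is_subfield_gen sM dim(1)] by blast
  have conj_y: "b \<in> M" if "a \<in> M" "conjugate base_y a b" for a b
    using nor(2) that unfolding normal_ext_iff[OF closed is_subfield_gen sM dim(2)] by blast
  have al_y: "alg base_y z" for z
    using sw.algebraic_over_base_x by (simp add: step_eval_swap)
  have fixed: "a \<in> base" if a: "a \<in> M" "\<And>\<sigma>. \<sigma> \<in> Gal type_ring M base_x \<union> Gal type_ring M base_y \<Longrightarrow> \<sigma> a = a" for a
  proof -
    have "a \<in> base_x"
      by (rule Gal_fixed_field[OF closed char is_subfield_gen sM dim(1,3) _ algebraic_over_base_x a(1)])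
         (use conj_x a(2) in blast)+
    moreover have "a \<in> base_y"
      by (rule Gal_fixed_field[OF closed char is_subfield_gen sM dim(2,4) _ al_y a(1)])
         (use conj_y a(2) in blast)+
    ultimately show ?thesis using sub by blast
  qed
  have "x \<in> M" using dim(1) base_x_memI(3) by blast
  then obtain p where p: "p \<noteq> 0" "poly p x = 0" "poly_over M p"
    "\<And>\<sigma> i. \<sigma> \<in> Gal type_ring M base_x \<union> Gal type_ring M base_y \<Longrightarrow> \<sigma> (Polynomial.coeff p i) = Polynomial.coeff p i"
    by (rule finite_group_invariant_poly[OF sM _ fin]) blast
  have "poly_over base p"
    unfolding poly_over_def using fixed p(3,4) by (simp add: poly_over_def)
  then show False
    using p(1,2) x_not_alg_over_base unfolding alg_def by blast
qed

section \<open>From a finite orbit to a finite Galois group\<close>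

lemma orbit_field_memI:
  "range \<iota> \<subseteq> orbit_field" "(u, v) \<in> orbit \<Longrightarrow> u \<in> orbit_field" "(u, v) \<in> orbit \<Longrightarrow> v \<in> orbit_field"
  using gen_incl[of "range \<iota> \<union> (fst ` orbit \<union> snd ` orbit)"] by force+

lemma base_x_subset_orbit_field: "base_x \<subseteq> orbit_field"
  using orbit_field_memI orbit_field_memI(2,3)[OF step_orbit_base]
    step_eval_in_subfield[OF is_subfield_gen orbit_field_memI(1)]
  by (intro gen_least is_subfield_gen) auto

text \<open>An embedding commutes with the step polynomial and, being injective, preserves
  definedness, so it respects steps of both kinds; fixing \<open>k(x)\<close> matters for the
  constants and the starting point. The larger domain \<open>L\<close> allows embeddings not yet
  known to map the orbit field into itself.\<close>

lemma embedding_preserves_orbit: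
  assumes L: "is_subfield L" "orbit_field \<subseteq> L" and \<tau>: "field_emb L \<tau>" "\<And>z. z \<in> base_x \<Longrightarrow> \<tau> z = z"
    and "(u, v) \<in> orbit"
  shows "(\<tau> u, \<tau> v) \<in> orbit"
proof -
  have \<iota>L: "range \<iota> \<subseteq> L" and fix\<iota>: "\<And>c. \<tau> (\<iota> c) = \<iota> c"
    using orbit_field_memI(1) L(2) base_x_memI(1) \<tau>(2) by blast+
  have inL: "u \<in> L" "v \<in> L" if "(u, v) \<in> orbit" for u v
    using orbit_field_memI(2,3)[OF that] L(2) by blast+
  have same: "same_step_value \<iota> S w (\<tau> u, \<tau> v) (\<tau> u', \<tau> v')"
    if "(u, v) \<in> orbit" "(u', v') \<in> orbit" "same_step_value \<iota> S w (u, v) (u', v')" for u v u' v'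
    using that(3) inL[OF that(1)] inL[OF that(2)]
    by (auto simp: same_step_value_def step_defined_def field_emb_simps(8)[OF \<tau>(1) L(1)]
        simp flip: field_emb_step_eval[OF \<tau>(1) L(1) \<iota>L fix\<iota>])
  have "(\<tau> (fst q), \<tau> (snd q)) \<in> orbit" if "q \<in> orbit" for q
    using that
  proof (induction rule: step_orbit_induct)
    \<comment> \<open>Since \<open>x\<close> and \<open>t\<close> are fixed, the image of
      \<open>(x, y)\<close> is one \<open>sim_x\<close> step away from it.\<close>
    case base
    have xy: "\<tau> x = x" "\<tau> t = t" using \<tau>(2) base_x_memI by blast+
    then have "step_eval \<iota> S w x (\<tau> y) = t"
      using field_emb_step_eval[OF \<tau>(1) L(1) \<iota>L fix\<iota> inL[OF step_orbit_base]] by simp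
    moreover have "\<tau> y \<noteq> 0"
      using field_emb_simps(8)[OF \<tau>(1) L(1) inL(2)[OF step_orbit_base]] coordinates_nonzero by blast
    ultimately have "sim_x \<iota> S w (x, y) (x, \<tau> y)"
      using coordinates_nonzero by (auto simp: sim_x_def same_step_value_def step_defined_def)
    then show ?case using step_orbit_step(1)[OF step_orbit_base] xy by simp
  next
    case (step_x p q)
    have q: "q \<in> orbit" using step_orbit_step(1)[OF step_x(1,2)] .
    have "sim_x \<iota> S w (\<tau> (fst p), \<tau> (snd p)) (\<tau> (fst q), \<tau> (snd q))"
      using step_x(2) same step_x(1) q by (cases p, cases q) (auto simp: sim_x_def)
    then show ?case using step_orbit_step(1)[OF step_x(3)] by blast
  next
    case (step_y p q)
    have q: "q \<in> orbit" using step_orbit_step(2)[OF step_y(1,2)] .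
    have "sim_y \<iota> S w (\<tau> (fst p), \<tau> (snd p)) (\<tau> (fst q), \<tau> (snd q))"
      using step_y(2) same step_y(1) q by (cases p, cases q) (auto simp: sim_y_def)
    then show ?case using step_orbit_step(2)[OF step_y(3)] by blast
  qed
  from this[OF assms(5)] show ?thesis by simp
qed

lemma embedding_orbit_field_into:
  assumes L: "is_subfield L" "orbit_field \<subseteq> L" and \<tau>: "field_emb L \<tau>" "\<And>z. z \<in> base_x \<Longrightarrow> \<tau> z = z"
    and "z \<in> orbit_field"
  shows "\<tau> z \<in> orbit_field"
proof -
  have gens: "\<tau> z \<in> orbit_field" if z: "z \<in> range \<iota> \<union> (fst ` orbit \<union> snd ` orbit)" for z
  proof -
    consider "z \<in> range \<iota>" | u v where "(u, v) \<in> orbit" "z = u \<or> z = v"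
      using z by force
    then show ?thesis
    proof cases
      case 1
      then have "\<tau> z = z" using \<tau>(2) base_x_memI(1) by blast
      then show ?thesis using 1 orbit_field_memI(1) by auto
    next
      case 2
      then show ?thesis
        using orbit_field_memI(2,3)[OF embedding_preserves_orbit[OF L \<tau> 2(1)]] by blast
    qed
  qed
  note s = is_subfieldD[OF is_subfield_gen[of "range \<iota> \<union> (fst ` orbit \<union> snd ` orbit)"]]
  note e = field_emb_simps[OF field_emb_mono[OF \<tau>(1) L(2)] is_subfield_gen]
  show ?thesis
    using assms(5)
    by (induction rule: generate_field.induct) (auto simp: e s gens)
qed

text \<open>Finitely many algebraic coordinates give finite dimension. A conjugate of an element of
  the orbit field is its image under an embedding over \<open>k(x)\<close>, which maps the orbit
  field into itself; this is normality.\<close>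

lemma finite_orbit_imp_galois:
  assumes "finite orbit"
  shows "finite_galois_ext type_ring base_x orbit_field"
proof -
  let ?E = "fst ` orbit \<union> snd ` orbit"
  have finE: "finite ?E" using assms by simp
  obtain es where es: "set es = ?E" using finite_list[OF finE] by (elim exE)
  have "orbit_field = gen (base_x \<union> set es)"
  proof
    show "orbit_field \<subseteq> gen (base_x \<union> set es)"
      using base_x_memI(1) es by (intro gen_least is_subfield_gen) (use gen_incl[of "base_x \<union> set es"] in blast)
    show "gen (base_x \<union> set es) \<subseteq> orbit_field"
      using base_x_subset_orbit_field gen_incl[of "range \<iota> \<union> ?E"] es by (intro gen_least is_subfield_gen) blast
  qed
  then have dim: "ring.finite_dimension type_ring base_x orbit_field"
    using finite_extension_eq_gen(2)[OF is_subfield_gen algebraic_over_base_x] by simp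
  have "b \<in> orbit_field" if a: "a \<in> orbit_field" and ab: "conjugate base_x a b" for a b
  proof -
    obtain L \<tau> where \<tau>: "is_subfield L" "base_x \<subseteq> L" "?E \<subseteq> L" "field_emb L \<tau>"
      "\<And>z. z \<in> base_x \<Longrightarrow> \<tau> z = z" "\<tau> a = b"
      by (rule conjugate_extend[OF closed finE is_subfield_gen algebraic_over_base_x ab]) blast
    have "orbit_field \<subseteq> L"
      using \<tau>(2,3) base_x_memI(1) by (intro gen_least \<tau>(1)) blast
    then show ?thesis
      using embedding_orbit_field_into[OF \<tau>(1) _ \<tau>(4,5) a] \<tau>(6) by simp
  qed
  then have "normal_ext type_ring base_x orbit_field"
    unfolding normal_ext_iff[OF closed is_subfield_gen is_subfield_gen base_x_subset_orbit_field]
    using algebraic_over_base_x by blast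
  moreover have "separable_ext type_ring base_x orbit_field"
    by (rule separable_ext_char_zero[OF char is_subfield_gen algebraic_over_base_x])
  ultimately show ?thesis
    using dim base_x_subset_orbit_field
    by (simp add: finite_galois_ext_def subfield_type_ring_iff is_subfield_gen)
qed

text \<open>Swapping only exchanges the two sets of coordinates, so results in the swapped setting
  concern the same field.\<close>

lemma orbit_field_swap:
  "gen (range \<iota> \<union> (fst ` step_orbit \<iota> (prod.swap ` S) (w \<circ> prod.swap) y x \<union>
      snd ` step_orbit \<iota> (prod.swap ` S) (w \<circ> prod.swap) y x)) = orbit_field"
  unfolding step_orbit_swap by (simp add: image_image Un_commute)

lemma Gal_preserves_orbit:
  assumes "\<sigma> \<in> Gal type_ring orbit_field base_x \<union> Gal type_ring orbit_field base_y" "(u, v) \<in> orbit"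
  shows "(\<sigma> u, \<sigma> v) \<in> orbit"
proof -
  interpret sw: step_setting "prod.swap ` S" "w \<circ> prod.swap" \<iota> y x by (rule swapped)
  consider "\<sigma> \<in> Gal type_ring orbit_field base_x" | "\<sigma> \<in> Gal type_ring orbit_field base_y"
    using assms(1) by blast
  then show ?thesis
  proof cases
    case 1
    then show ?thesis
      using embedding_preserves_orbit[OF is_subfield_gen order_refl _ _ assms(2)]
      by (simp add: Gal_iff[OF is_subfield_gen])
  next
    case 2
    then have "field_emb sw.orbit_field \<sigma>" "\<And>z. z \<in> sw.base_x \<Longrightarrow> \<sigma> z = z"
      unfolding orbit_field_swap step_eval_swap by (simp_all add: Gal_iff[OF is_subfield_gen])
    then have "(\<sigma> v, \<sigma> u) \<in> sw.orbit"
      by (rule sw.embedding_preserves_orbit[OF is_subfield_gen order_refl])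
         (use imageI[OF assms(2), of prod.swap] in \<open>simp_all add: step_orbit_swap\<close>)
    then show ?thesis by (auto simp: step_orbit_swap)
  qed
qed

text \<open>Every element of the group fixes the constants and maps the finite set \<open>?E\<close>
  of coordinates into itself. Constants and coordinates generate the field, so restriction to
  \<open>?E\<close> embeds the group into a finite set of functions.\<close>

lemma finite_orbit_imp_finite_group:
  assumes "finite orbit"
  shows "finite (generate (RingAutoGroup (type_ring\<lparr>carrier := orbit_field\<rparr>))
           (Gal type_ring orbit_field base_x \<union> Gal type_ring orbit_field base_y))"
proof -
  let ?M = orbit_field
  let ?R = "RingAutoGroup (type_ring\<lparr>carrier := ?M\<rparr>)"
  let ?H = "Gal type_ring ?M base_x \<union> Gal type_ring ?M base_y"
  let ?E = "fst ` orbit \<union> snd ` orbit"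
  note M = is_subfield_gen[of "range \<iota> \<union> ?E"]
  interpret sw: step_setting "prod.swap ` S" "w \<circ> prod.swap" \<iota> y x by (rule swapped)
  have by_sub: "base_y \<subseteq> ?M"
    using sw.base_x_subset_orbit_field unfolding orbit_field_swap step_eval_swap .
  \<comment> \<open>\<open>generate\<close> also admits inverses of generators; as these are Galois
    automorphisms again, that case below reduces to the generators.\<close>
  have inv_Gal: "inv\<^bsub>?R\<^esub> h \<in> ?H" if h: "h \<in> ?H" for h
  proof -
    have hB: "h \<in> Bij ?M" and hE: "field_emb ?M h" using h by (auto simp: Gal_iff[OF M])
    have inj: "inj_on h ?M" using hB by (simp add: Bij_def bij_betw_def)
    have "inv\<^bsub>?R\<^esub> h \<in> carrier ?R"
      using hB hE by (intro group.inv_closed[OF group_RingAutoGroup[OF M]]) (simp add: RingAutoGroup_type_ring[OF M])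
    then have "field_emb ?M (inv\<^bsub>?R\<^esub> h)" "inv\<^bsub>?R\<^esub> h \<in> Bij ?M"
      by (simp_all add: RingAutoGroup_type_ring[OF M])
    moreover have "(inv\<^bsub>?R\<^esub> h) z = z" if "h z = z" "z \<in> ?M" for z
      using that inv_into_f_f[OF inj that(2)] by (simp add: RingAutoGroup_simps(3)[OF M hB hE])
    ultimately show ?thesis
      using h base_x_subset_orbit_field by_sub by (simp add: Gal_iff[OF M]) blast
  qed
  have act: "(\<forall>(u, v)\<in>orbit. (g u, g v) \<in> orbit) \<and> (\<forall>c. g (\<iota> c) = \<iota> c)" if "g \<in> generate ?R ?H" for g
    using that
  proof (induction rule: generate.induct)
    case one
    then show ?case
      using orbit_field_memI by (auto simp: RingAutoGroup_simps(1)[OF M])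
  next
    case (incl h)
    then show ?case
      using Gal_preserves_orbit base_x_memI(1) sw.base_x_memI(1)
      by (fastforce simp: Gal_iff[OF M] step_eval_swap)
  next
    case (inv h)
    then show ?case
      using Gal_preserves_orbit[OF inv_Gal[OF inv]] inv_Gal[OF inv] base_x_memI(1) sw.base_x_memI(1)
      by (fastforce simp: Gal_iff[OF M] step_eval_swap)
  next
    case (eng g h)
    have "g \<otimes>\<^bsub>?R\<^esub> h = compose ?M g h"
      using RingAutoGroup_simps(2)[OF M] generate_Gal_subset(2)[OF M eng(1)] generate_Gal_subset(2)[OF M eng(2)] by blast
    moreover have "(g u, g v) \<in> orbit" "(h u, h v) \<in> orbit" if "(u, v) \<in> orbit" for u v
      using eng(3,4) that by auto
    moreover have "\<iota> c \<in> ?M" for c using orbit_field_memI(1) by blast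
    ultimately show ?case
      using eng(3,4) orbit_field_memI(2,3) by (auto simp: compose_eq)
  qed
  have "inj_on (\<lambda>g. restrict g ?E) (generate ?R ?H)"
  proof (rule inj_onI)
    fix g h assume g: "g \<in> generate ?R ?H" and h: "h \<in> generate ?R ?H" and eq: "restrict g ?E = restrict h ?E"
    have "g z = h z" if "z \<in> ?M" for z
    proof (rule field_emb_eq_on_gen[OF generate_Gal_subset(1)[OF M g] generate_Gal_subset(1)[OF M h] _ that])
      fix a assume a: "a \<in> range \<iota> \<union> ?E"
      show "g a = h a"
      proof (cases "a \<in> ?E")
        case True
        then show ?thesis using fun_cong[OF eq, of a] by (metis restrict_apply')
      next
        case False
        then obtain c where "a = \<iota> c" using a by blast
        then show ?thesis using act[OF g] act[OF h] by metis
      qed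
    qed
    moreover have "g \<in> extensional ?M" "h \<in> extensional ?M"
      \<comment> \<open>Members of \<open>Bij\<close> are extensional, so agreement on the field
        gives equality of functions.\<close>
      using generate_Gal_subset(2)[OF M] g h Bij_imp_extensional by blast+
    ultimately show "g = h" by (intro extensionalityI) auto
  qed
  moreover have "(\<lambda>g. restrict g ?E) ` generate ?R ?H \<subseteq> (?E \<rightarrow>\<^sub>E ?E)"
  proof (intro image_subsetI restrict_PiE_iff[THEN iffD2] ballI)
    fix g e assume "g \<in> generate ?R ?H" "e \<in> ?E"
    moreover from this obtain u v where "(u, v) \<in> orbit" "e = u \<or> e = v" by force
    ultimately have "(g u, g v) \<in> orbit" using act by blast
    then show "g e \<in> ?E" using \<open>e = u \<or> e = v\<close> by force
  qed
  moreover have "finite (?E \<rightarrow>\<^sub>E ?E)"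
    using assms by (intro finite_PiE) auto
  ultimately show ?thesis
    by (rule inj_on_finite)
qed

end

theorem mainTheorem3:
  fixes S :: "(int \<times> int) set"
    and w :: "int \<times> int \<Rightarrow> complex"
    and \<iota> :: "complex \<Rightarrow> 'k::field"
    and x y :: 'k
    and K :: "'k ring"
    and k kx ky :: "'k set"
  assumes finite_steps: "finite S"
    and weights_nonzero: "\<And>s. s \<in> S \<Longrightarrow> w s \<noteq> 0"
    and involves_X: "\<exists>s\<in>S. fst s \<noteq> 0"
    and involves_Y: "\<exists>s\<in>S. snd s \<noteq> 0"
    and K_def: "K = ring_of_type_algebra"
    and embedding: "\<iota> \<in> ring_hom (ring_of_type_algebra :: complex ring) K"
    and independent: "alg_independent2 \<iota> x y"
    and closure: "algebraic_closure K (generate_field K (range \<iota> \<union> {x, y}))"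
    and k_def: "k = generate_field K (range \<iota> \<union> {step_eval \<iota> S w x y})"
    and kx_def: "kx = generate_field K (k \<union> {x})"
    and ky_def: "ky = generate_field K (k \<union> {y})"
  shows "(finite (step_orbit \<iota> S w x y) \<longleftrightarrow>
            (\<exists>M. subfield M K \<and> finite_galois_ext K kx M \<and> finite_galois_ext K ky M \<and>
                 finite (generate (RingAutoGroup (K\<lparr>carrier := M\<rparr>)) (Gal K M kx \<union> Gal K M ky)))) \<and>
         (finite (step_orbit \<iota> S w x y) \<longleftrightarrow> k \<subset> kx \<inter> ky)"
proof -
  note tr = alg_independent2_imp_transcendental[OF embedding[unfolded K_def] independent]
  have hom: "\<iota> (a + b) = \<iota> a + \<iota> b" "\<iota> 1 = 1" for a b
    using ring_hom_add[OF embedding, of a b] ring_hom_one[OF embedding]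
    by (simp_all add: K_def ring_of_type_algebra_def)
  \<comment> \<open>The injective homomorphism \<open>\<iota>\<close> carries characteristic zero
    over from the complex numbers.\<close>
  have "\<iota> (of_nat n) = of_nat n" for n
    by (induction n) (simp_all add: hom tr(4))
  then have char: "char_zero TYPE('k)"
    unfolding char_zero_def using tr(4,5) by (metis injD of_nat_eq_0_iff less_numeral_extra(3))
  interpret step_setting S w \<iota> x y
  proof
    show "\<iota> c = 0 \<longleftrightarrow> c = 0" for c
      using tr(4,5) by (metis injD)
  qed (use assms tr char alg_closed_of_closure[OF closure[unfolded K_def]]
        alg_of_closure(1)[OF closure[unfolded K_def]] in auto)
  interpret sw: step_setting "prod.swap ` S" "w \<circ> prod.swap" \<iota> y x by (rule swapped)
  have k: "k = base"
    by (simp add: k_def K_def)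
  \<comment> \<open>The fields generated in two stages, first \<open>k\<close> and then a variable,
    are flattened to a single set of generators.\<close>
  have kx: "kx = base_x" and ky: "ky = base_y"
    unfolding kx_def ky_def k_def K_def gen_gen_Un by (simp_all add: insert_commute)
  have sub: "base \<subseteq> base_x" "base \<subseteq> base_y"
    by (rule gen_mono, blast)+
  let ?P = "\<lambda>M. subfield M K \<and> finite_galois_ext K kx M \<and> finite_galois_ext K ky M \<and>
      finite (generate (RingAutoGroup (K\<lparr>carrier := M\<rparr>)) (Gal K M kx \<union> Gal K M ky))"
  have 1: "?P orbit_field" if "finite orbit"
  proof -
    have "finite sw.orbit" using that by (simp add: step_orbit_swap)
    then have "finite_galois_ext type_ring base_y orbit_field"
      using sw.finite_orbit_imp_galois unfolding orbit_field_swap step_eval_swap by blast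
    then show ?thesis
      using finite_orbit_imp_galois[OF that] finite_orbit_imp_finite_group[OF that]
      unfolding kx ky K_def by (simp add: subfield_type_ring_iff is_subfield_gen)
  qed
  have 2: "k \<subset> kx \<inter> ky" if "?P M" for M
    using finite_galois_imp_invariant[of M] that sub unfolding k kx ky K_def by blast
  have 3: "finite orbit" if "k \<subset> kx \<inter> ky"
    using invariant_imp_finite_orbit that unfolding k kx ky by blast
  show ?thesis
    using 1 2 3 by blast
qed

end
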